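(* For a pointed finitely complete category $\mathbb{X}$ the following are equivalent: (a) a morphism in $\mathbb{X}$ is a monomorphism if and only if its kernel is $0$; (b) for each object $B$ in $\mathbb{X}$ the functor $\mathrm{Ker}_B:\mathbf{Pt}_{\mathbb{X}}(B)\to\mathbb{X}$ reflects terminal objects; (c) for each object $B$ in $\mathbb{X}$ the functor $\mathrm{Ker}_B:\mathbf{Pt}_{\mathbb{X}}(B)\to\mathbb{X}$ reflects monomorphisms; (d) for each object $B$ in $\mathbb{X}$, in the (pointed) category $\mathbf{Pt}_{\mathbb{X}}(B)$ a morphism is a monomorphism if and only if its kernel is $0$; (e) for each morphism $p:E\to B$ in $\mathbb{X}$ the functor $p^*:\mathbf{Pt}_{\mathbb{X}}(B)\to\mathbf{Pt}_{\mathbb{X}}(E)$ reflects terminal objects; (f) for each morphism $p:E\to B$ in $\mathbb{X}$ the functor $p^*:\mathbf{Pt}_{\mathbb{X}}(B)\to\mathbf{Pt}_{\mathbb{X}}(E)$ reflects monomorphisms.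
   Context: For an object $B$ of $\mathbb{X}$, the category of points $\mathbf{Pt}_{\mathbb{X}}(B)$ has as objects triples $(A,\alpha,\beta)$ where $A$ is an object of $\mathbb{X}$ and $\alpha:A\to B$, $\beta:B\to A$ are morphisms with $\alpha\beta=1_B$. A morphism $(A,\alpha,\beta)\to(A',\alpha',\beta')$ is a morphism $f:A\to A'$ of $\mathbb{X}$ with $\alpha'f=\alpha$ and $f\beta=\beta'$. This category is pointed, with zero object $(B,1_B,1_B)$. A morphism $p:E\to B$ determines the pullback functor $p^*:\mathbf{Pt}_{\mathbb{X}}(B)\to\mathbf{Pt}_{\mathbb{X}}(E)$ sending $(A,\alpha,\beta)$ to $(E\times_B A,\pi_1,\langle 1,\beta p\rangle)$, where $E\times_BA$ is the pullback of $p$ and $\alpha$ with projections $\pi_1$ to $E$ and $\pi_2$ to $A$. The functor $\mathrm{Ker}_B:\mathbf{Pt}_{\mathbb{X}}(B)\to\mathbb{X}$ sends $(A,\alpha,\beta)$ to the (domain of the) kernel of $\alpha$; it is essentially the pullback functor along $0\to B$. A functor $F$ reflects terminal objects if $Z$ is terminal whenever $F(Z)$ is, and reflects monomorphisms if $f$ is a monomorphism whenever $F(f)$ is. *)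

theory Defs
  imports Main
begin

section \<open>Categories, functors, limits\<close>

record ('o, 'm) cat =
  Obj :: "'o set"
  Arr :: "'m set"
  Dom :: "'m \<Rightarrow> 'o"
  Cod :: "'m \<Rightarrow> 'o"
  Idn :: "'o \<Rightarrow> 'm"
  Comp :: "'m \<Rightarrow> 'm \<Rightarrow> 'm"  (infixl "\<cdot>\<index>" 70)

definition hom :: "('o, 'm) cat \<Rightarrow> 'o \<Rightarrow> 'o \<Rightarrow> 'm set" where
  "hom C a b = {f \<in> Arr C. Dom C f = a \<and> Cod C f = b}"

definition category :: "('o, 'm) cat \<Rightarrow> bool" where
  "category C \<longleftrightarrow>
     (\<forall>f\<in>Arr C. Dom C f \<in> Obj C \<and> Cod C f \<in> Obj C) \<and>
     (\<forall>a\<in>Obj C. Idn C a \<in> hom C a a) \<and>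
     (\<forall>f\<in>Arr C. \<forall>g\<in>Arr C. Cod C f = Dom C g \<longrightarrow> g \<cdot>\<^bsub>C\<^esub> f \<in> hom C (Dom C f) (Cod C g)) \<and>
     (\<forall>f\<in>Arr C. f \<cdot>\<^bsub>C\<^esub> Idn C (Dom C f) = f \<and> Idn C (Cod C f) \<cdot>\<^bsub>C\<^esub> f = f) \<and>
     (\<forall>f\<in>Arr C. \<forall>g\<in>Arr C. \<forall>h\<in>Arr C. Cod C f = Dom C g \<longrightarrow> Cod C g = Dom C h \<longrightarrow>
        (h \<cdot>\<^bsub>C\<^esub> g) \<cdot>\<^bsub>C\<^esub> f = h \<cdot>\<^bsub>C\<^esub> (g \<cdot>\<^bsub>C\<^esub> f))"

record ('o, 'm, 'p, 'n) ftor =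
  Src :: "('o, 'm) cat"
  Tgt :: "('p, 'n) cat"
  OMap :: "'o \<Rightarrow> 'p"
  AMap :: "'m \<Rightarrow> 'n"

definition is_functor :: "('o, 'm, 'p, 'n) ftor \<Rightarrow> bool" where
  "is_functor F \<longleftrightarrow>
     category (Src F) \<and> category (Tgt F) \<and>
     (\<forall>a\<in>Obj (Src F). OMap F a \<in> Obj (Tgt F)) \<and>
     (\<forall>f\<in>Arr (Src F). AMap F f \<in> hom (Tgt F) (OMap F (Dom (Src F) f)) (OMap F (Cod (Src F) f))) \<and>
     (\<forall>a\<in>Obj (Src F). AMap F (Idn (Src F) a) = Idn (Tgt F) (OMap F a)) \<and>
     (\<forall>f\<in>Arr (Src F). \<forall>g\<in>Arr (Src F). Cod (Src F) f = Dom (Src F) g \<longrightarrow>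
        AMap F (g \<cdot>\<^bsub>Src F\<^esub> f) = AMap F g \<cdot>\<^bsub>Tgt F\<^esub> AMap F f)"

definition is_cone :: "('j, 'i, 'o, 'm) ftor \<Rightarrow> 'o \<Rightarrow> ('j \<Rightarrow> 'm) \<Rightarrow> bool" where
  "is_cone F L \<pi> \<longleftrightarrow>
     L \<in> Obj (Tgt F) \<and>
     (\<forall>j\<in>Obj (Src F). \<pi> j \<in> hom (Tgt F) L (OMap F j)) \<and>
     (\<forall>u\<in>Arr (Src F). AMap F u \<cdot>\<^bsub>Tgt F\<^esub> \<pi> (Dom (Src F) u) = \<pi> (Cod (Src F) u))"

definition is_limit :: "('j, 'i, 'o, 'm) ftor \<Rightarrow> 'o \<Rightarrow> ('j \<Rightarrow> 'm) \<Rightarrow> bool" where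
  "is_limit F L \<pi> \<longleftrightarrow>
     is_cone F L \<pi> \<and>
     (\<forall>M \<mu>. is_cone F M \<mu> \<longrightarrow>
        (\<exists>!h. h \<in> hom (Tgt F) M L \<and> (\<forall>j\<in>Obj (Src F). \<pi> j \<cdot>\<^bsub>Tgt F\<^esub> h = \<mu> j)))"

text \<open>Every finite category is isomorphic to one whose objects and morphisms are natural
  numbers, so it suffices to let the shapes of diagrams range over such categories.\<close>

definition finitely_complete :: "('o, 'm) cat \<Rightarrow> bool" where
  "finitely_complete C \<longleftrightarrow>
     (\<forall>F :: (nat, nat, 'o, 'm) ftor.
        is_functor F \<and> Tgt F = C \<and> finite (Obj (Src F)) \<and> finite (Arr (Src F)) \<longrightarrow>
        (\<exists>L \<pi>. is_limit F L \<pi>))"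

definition mono_arr :: "('o, 'm) cat \<Rightarrow> 'm \<Rightarrow> bool" where
  "mono_arr C f \<longleftrightarrow>
     f \<in> Arr C \<and>
     (\<forall>g\<in>Arr C. \<forall>h\<in>Arr C. Cod C g = Dom C f \<longrightarrow> Cod C h = Dom C f \<longrightarrow> Dom C g = Dom C h \<longrightarrow>
        f \<cdot>\<^bsub>C\<^esub> g = f \<cdot>\<^bsub>C\<^esub> h \<longrightarrow> g = h)"

definition terminal :: "('o, 'm) cat \<Rightarrow> 'o \<Rightarrow> bool" where
  "terminal C z \<longleftrightarrow> z \<in> Obj C \<and> (\<forall>a\<in>Obj C. \<exists>!f. f \<in> hom C a z)"

definition initial :: "('o, 'm) cat \<Rightarrow> 'o \<Rightarrow> bool" where
  "initial C z \<longleftrightarrow> z \<in> Obj C \<and> (\<forall>a\<in>Obj C. \<exists>!f. f \<in> hom C z a)"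

definition reflects_terminal_objects :: "('o, 'm, 'p, 'n) ftor \<Rightarrow> bool" where
  "reflects_terminal_objects F \<longleftrightarrow>
     (\<forall>Z\<in>Obj (Src F). terminal (Tgt F) (OMap F Z) \<longrightarrow> terminal (Src F) Z)"

definition reflects_monomorphisms :: "('o, 'm, 'p, 'n) ftor \<Rightarrow> bool" where
  "reflects_monomorphisms F \<longleftrightarrow>
     (\<forall>f\<in>Arr (Src F). mono_arr (Tgt F) (AMap F f) \<longrightarrow> mono_arr (Src F) f)"


section \<open>Pointed categories, kernels, pullbacks\<close>

definition zero_object :: "('o, 'm) cat \<Rightarrow> 'o \<Rightarrow> bool" where
  "zero_object C z \<longleftrightarrow> initial C z \<and> terminal C z"

definition pointed :: "('o, 'm) cat \<Rightarrow> bool" where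
  "pointed C \<longleftrightarrow> (\<exists>z. zero_object C z)"

definition zero_arr :: "('o, 'm) cat \<Rightarrow> 'm \<Rightarrow> bool" where
  "zero_arr C f \<longleftrightarrow>
     (\<exists>z u v. zero_object C z \<and> u \<in> hom C (Dom C f) z \<and> v \<in> hom C z (Cod C f) \<and> f = v \<cdot>\<^bsub>C\<^esub> u)"

definition is_kernel :: "('o, 'm) cat \<Rightarrow> 'm \<Rightarrow> 'm \<Rightarrow> bool" where
  "is_kernel C f k \<longleftrightarrow>
     k \<in> Arr C \<and> Cod C k = Dom C f \<and> zero_arr C (f \<cdot>\<^bsub>C\<^esub> k) \<and>
     (\<forall>g\<in>Arr C. Cod C g = Dom C f \<and> zero_arr C (f \<cdot>\<^bsub>C\<^esub> g) \<longrightarrow>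
        (\<exists>!h. h \<in> hom C (Dom C g) (Dom C k) \<and> k \<cdot>\<^bsub>C\<^esub> h = g))"

text \<open>Kernels and pullbacks are determined only up to isomorphism; \<open>kernel\<close> and
  \<open>pullback\<close> fix one choice of each.\<close>

definition kernel :: "('o, 'm) cat \<Rightarrow> 'm \<Rightarrow> 'm" where
  "kernel C f = (SOME k. is_kernel C f k)"

definition kernel_is_zero :: "('o, 'm) cat \<Rightarrow> 'm \<Rightarrow> bool" where
  "kernel_is_zero C f \<longleftrightarrow> zero_object C (Dom C (kernel C f))"

definition is_pullback :: "('o, 'm) cat \<Rightarrow> 'm \<Rightarrow> 'm \<Rightarrow> 'm \<times> 'm \<Rightarrow> bool" where
  "is_pullback C f g = (\<lambda>(p, q).
     p \<in> Arr C \<and> q \<in> Arr C \<and> Dom C p = Dom C q \<and> Cod C p = Dom C f \<and> Cod C q = Dom C g \<and>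
     f \<cdot>\<^bsub>C\<^esub> p = g \<cdot>\<^bsub>C\<^esub> q \<and>
     (\<forall>x\<in>Arr C. \<forall>y\<in>Arr C. Dom C x = Dom C y \<and> Cod C x = Dom C f \<and> Cod C y = Dom C g \<and>
        f \<cdot>\<^bsub>C\<^esub> x = g \<cdot>\<^bsub>C\<^esub> y \<longrightarrow>
        (\<exists>!h. h \<in> hom C (Dom C x) (Dom C p) \<and> p \<cdot>\<^bsub>C\<^esub> h = x \<and> q \<cdot>\<^bsub>C\<^esub> h = y)))"

definition pullback :: "('o, 'm) cat \<Rightarrow> 'm \<Rightarrow> 'm \<Rightarrow> 'm \<times> 'm" where
  "pullback C f g = (SOME pq. is_pullback C f g pq)"

definition proj1 :: "('o, 'm) cat \<Rightarrow> 'm \<Rightarrow> 'm \<Rightarrow> 'm" where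
  "proj1 C f g = fst (pullback C f g)"

definition proj2 :: "('o, 'm) cat \<Rightarrow> 'm \<Rightarrow> 'm \<Rightarrow> 'm" where
  "proj2 C f g = snd (pullback C f g)"

definition pb_obj :: "('o, 'm) cat \<Rightarrow> 'm \<Rightarrow> 'm \<Rightarrow> 'o" where
  "pb_obj C f g = Dom C (proj1 C f g)"

text \<open>The morphism \<open>\<langle>x, y\<rangle>\<close> into the pullback of \<open>f\<close> and \<open>g\<close>.\<close>

definition pb_pair :: "('o, 'm) cat \<Rightarrow> 'm \<Rightarrow> 'm \<Rightarrow> 'm \<Rightarrow> 'm \<Rightarrow> 'm" where
  "pb_pair C f g x y =
     (THE h. h \<in> hom C (Dom C x) (pb_obj C f g) \<and>
        proj1 C f g \<cdot>\<^bsub>C\<^esub> h = x \<and> proj2 C f g \<cdot>\<^bsub>C\<^esub> h = y)"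


section \<open>The category of points\<close>

type_synonym ('o, 'm) point = "'o \<times> 'm \<times> 'm"

text \<open>A morphism of points is stored together with its source and target, since the same
  morphism of \<open>X\<close> may underlie morphisms between different points.\<close>

type_synonym ('o, 'm) point_arr = "('o, 'm) point \<times> 'm \<times> ('o, 'm) point"

definition points :: "('o, 'm) cat \<Rightarrow> 'o \<Rightarrow> ('o, 'm) point set" where
  "points X B =
     {(A, \<alpha>, \<beta>). A \<in> Obj X \<and> \<alpha> \<in> hom X A B \<and> \<beta> \<in> hom X B A \<and> \<alpha> \<cdot>\<^bsub>X\<^esub> \<beta> = Idn X B}"

definition Pt :: "('o, 'm) cat \<Rightarrow> 'o \<Rightarrow> (('o, 'm) point, ('o, 'm) point_arr) cat" where
  "Pt X B =
    \<lparr>Obj = points X B,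
     Arr = {((A, \<alpha>, \<beta>), f, (A', \<alpha>', \<beta>')).
              (A, \<alpha>, \<beta>) \<in> points X B \<and> (A', \<alpha>', \<beta>') \<in> points X B \<and>
              f \<in> hom X A A' \<and> \<alpha>' \<cdot>\<^bsub>X\<^esub> f = \<alpha> \<and> f \<cdot>\<^bsub>X\<^esub> \<beta> = \<beta>'},
     Dom = (\<lambda>(S, f, T). S),
     Cod = (\<lambda>(S, f, T). T),
     Idn = (\<lambda>(A, \<alpha>, \<beta>). ((A, \<alpha>, \<beta>), Idn X A, (A, \<alpha>, \<beta>))),
     Comp = (\<lambda>(_, g, T) (S, f, _). (S, g \<cdot>\<^bsub>X\<^esub> f, T))\<rparr>"

definition Ker :: "('o, 'm) cat \<Rightarrow> 'o \<Rightarrow> (('o, 'm) point, ('o, 'm) point_arr, 'o, 'm) ftor" where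
  "Ker X B =
    \<lparr>Src = Pt X B,
     Tgt = X,
     OMap = (\<lambda>(A, \<alpha>, \<beta>). Dom X (kernel X \<alpha>)),
     AMap = (\<lambda>((A, \<alpha>, \<beta>), f, (A', \<alpha>', \<beta>')).
       THE h. h \<in> hom X (Dom X (kernel X \<alpha>)) (Dom X (kernel X \<alpha>')) \<and>
              kernel X \<alpha>' \<cdot>\<^bsub>X\<^esub> h = f \<cdot>\<^bsub>X\<^esub> kernel X \<alpha>)\<rparr>"

definition pb_point :: "('o, 'm) cat \<Rightarrow> 'm \<Rightarrow> ('o, 'm) point \<Rightarrow> ('o, 'm) point" where
  "pb_point X p = (\<lambda>(A, \<alpha>, \<beta>).
     (pb_obj X p \<alpha>, proj1 X p \<alpha>, pb_pair X p \<alpha> (Idn X (Dom X p)) (\<beta> \<cdot>\<^bsub>X\<^esub> p)))"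

text \<open>On morphisms, \<open>p\<^sup>*(f) = \<langle>\<pi>\<^sub>1, f \<pi>\<^sub>2\<rangle>\<close>.\<close>

definition pb_functor ::
  "('o, 'm) cat \<Rightarrow> 'm \<Rightarrow>
     (('o, 'm) point, ('o, 'm) point_arr, ('o, 'm) point, ('o, 'm) point_arr) ftor" where
  "pb_functor X p =
    \<lparr>Src = Pt X (Cod X p),
     Tgt = Pt X (Dom X p),
     OMap = pb_point X p,
     AMap = (\<lambda>((A, \<alpha>, \<beta>), f, (A', \<alpha>', \<beta>')).
       (pb_point X p (A, \<alpha>, \<beta>),
        pb_pair X p \<alpha>' (proj1 X p \<alpha>) (f \<cdot>\<^bsub>X\<^esub> proj2 X p \<alpha>),
        pb_point X p (A', \<alpha>', \<beta>')))\<rparr>"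

end

theory Submission
  imports Defs
begin

text \<open>The first projection of the kernel pair of \<open>f\<close> is a split epimorphism with the same kernel
  as \<open>f\<close>, and if it is a monomorphism then so is \<open>f\<close>. Hence (a) only has to be tested on split
  epimorphisms, which is (b). If \<open>Ker\<^sub>B(f)\<close> or \<open>p\<^sup>*(f)\<close> is a monomorphism, or if \<open>f\<close> has zero
  kernel in the category of points, then \<open>f\<close> has zero kernel in the base category, so (a) yields
  the other conditions. Conversely, (c) gives (b) and (f) gives (e) by looking at \<open>\<alpha>\<close> as the
  morphism from \<open>(A, \<alpha>, \<beta>)\<close> to the zero object, (e) gives (b) by pulling back along \<open>0 \<rightarrow> B\<close>,
  and (d) gives (a) by taking \<open>B = 0\<close>.\<close>

section \<open>Zero morphisms, pullbacks and kernels\<close>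

text \<open>The six conditions are linked through one implication, "trivial kernel implies mono",
  tested on all morphisms, on retractions of points, or inside a category of points. Two facts let
  it travel between levels: a morphism of points is mono exactly when its underlying morphism is,
  and a point is terminal exactly when its retraction is mono. Zero morphisms transfer less simply.
  In \<open>Pt X B\<close> they factor through \<open>B\<close>, so the underlying morphism is
  \<open>\<beta>' \<cdot> \<alpha>\<close> and in general not a zero morphism of \<open>X\<close>;
  kernels of points are therefore pullbacks along \<open>\<beta>'\<close>. Since
  \<open>kernel\<close> is a \<open>SOME\<close> choice, it carries information only where a kernel
  exists, so existence has to be proved in \<open>Pt X B\<close> as well. The facts on zero
  morphisms live in a locale assuming just a pointed category, so that they can be instantiated with
  \<open>Pt X B\<close> directly.\<close>

locale cat =
  fixes C :: "('o, 'm) cat" (structure)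
  assumes category: "category C"
begin

lemma ArrI: "f \<in> hom C a b \<Longrightarrow> f \<in> Arr C"
  and Dom_hom: "f \<in> hom C a b \<Longrightarrow> Dom C f = a"
  and Cod_hom: "f \<in> hom C a b \<Longrightarrow> Cod C f = b"
  and Arr_in_hom: "f \<in> Arr C \<Longrightarrow> f \<in> hom C (Dom C f) (Cod C f)"
  by (auto simp: hom_def)

lemma hom_Obj: "f \<in> hom C a b \<Longrightarrow> a \<in> Obj C \<and> b \<in> Obj C"
  using category unfolding category_def hom_def by blast

lemma Idn_in: "a \<in> Obj C \<Longrightarrow> Idn C a \<in> hom C a a"
  using category unfolding category_def by blast

lemma comp_in:
  assumes "f \<in> hom C a b" "g \<in> hom C b c"
  shows "g \<cdot> f \<in> hom C a c"
proof -
  have "\<forall>f\<in>Arr C. \<forall>g\<in>Arr C. Cod C f = Dom C g \<longrightarrow> g \<cdot> f \<in> hom C (Dom C f) (Cod C g)"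
    using category unfolding category_def by (elim conjE)
  then show ?thesis using assms by (simp add: hom_def)
qed

lemma Idn_right: "f \<in> hom C a b \<Longrightarrow> f \<cdot> Idn C a = f"
  and Idn_left: "f \<in> hom C a b \<Longrightarrow> Idn C b \<cdot> f = f"
proof -
  have "\<forall>f\<in>Arr C. f \<cdot> Idn C (Dom C f) = f \<and> Idn C (Cod C f) \<cdot> f = f"
    using category unfolding category_def by (elim conjE)
  then show "f \<in> hom C a b \<Longrightarrow> f \<cdot> Idn C a = f" "f \<in> hom C a b \<Longrightarrow> Idn C b \<cdot> f = f"
    by (auto simp: hom_def)
qed

lemma assoc:
  assumes "f \<in> hom C a b" "g \<in> hom C b c" "h \<in> hom C c d"
  shows "(h \<cdot> g) \<cdot> f = h \<cdot> (g \<cdot> f)"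
proof -
  have "\<forall>f\<in>Arr C. \<forall>g\<in>Arr C. \<forall>h\<in>Arr C. Cod C f = Dom C g \<longrightarrow> Cod C g = Dom C h \<longrightarrow>
      (h \<cdot> g) \<cdot> f = h \<cdot> (g \<cdot> f)"
    using category unfolding category_def by (elim conjE)
  then show ?thesis using assms by (simp add: hom_def)
qed

lemma mono_arr_iff:
  assumes "f \<in> hom C a b"
  shows "mono_arr C f \<longleftrightarrow> (\<forall>e. \<forall>g\<in>hom C e a. \<forall>h\<in>hom C e a. f \<cdot> g = f \<cdot> h \<longrightarrow> g = h)"
  using assms unfolding mono_arr_def hom_def by auto

lemma terminalE:
  assumes "terminal C z" "a \<in> Obj C"
  obtains f where "f \<in> hom C a z"
  using assms unfolding terminal_def by (meson ex1_implies_ex)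

lemma initialE:
  assumes "initial C z" "a \<in> Obj C"
  obtains f where "f \<in> hom C z a"
  using assms unfolding initial_def by (meson ex1_implies_ex)

lemma terminal_unique:
  assumes "terminal C z" "f \<in> hom C a z" "g \<in> hom C a z"
  shows "f = g"
proof -
  have "\<exists>!f. f \<in> hom C a z"
    using assms(1) hom_Obj[OF assms(2)] unfolding terminal_def by simp
  then show ?thesis using assms(2,3) by blast
qed

lemma initial_unique:
  assumes "initial C z" "f \<in> hom C z a" "g \<in> hom C z a"
  shows "f = g"
proof -
  have "\<exists>!f. f \<in> hom C z a"
    using assms(1) hom_Obj[OF assms(2)] unfolding initial_def by simp
  then show ?thesis using assms(2,3) by blast
qed

lemma mono_from_terminal:
  assumes "f \<in> hom C a b" "terminal C a"
  shows "mono_arr C f"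
  unfolding mono_arr_iff[OF assms(1)] using terminal_unique[OF assms(2)] by blast

end

section \<open>Zero morphisms and trivial kernels in a pointed category\<close>

locale pointed_cat = cat +
  assumes pointed: "pointed C"
begin

lemma zero_arrI:
  assumes "zero_object C z" "u \<in> hom C a z" "v \<in> hom C z b"
  shows "zero_arr C (v \<cdot> u)"
  unfolding zero_arr_def
  using assms(1,2,3) Dom_hom[OF comp_in[OF assms(2,3)]] Cod_hom[OF comp_in[OF assms(2,3)]] by blast

lemma zero_arrE:
  assumes "f \<in> hom C a b" "zero_arr C f"
  obtains z u v where "zero_object C z" "u \<in> hom C a z" "v \<in> hom C z b" "f = v \<cdot> u"
  using assms(2) unfolding zero_arr_def Dom_hom[OF assms(1)] Cod_hom[OF assms(1)] by blast

text \<open>The two factorizations may use different zero objects; a comparison \<open>w\<close>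
  between these turns one factorization into the other, by initiality on one side and terminality on
  the other.\<close>

lemma zero_arr_unique:
  assumes "f \<in> hom C a b" "g \<in> hom C a b" "zero_arr C f" "zero_arr C g"
  shows "f = g"
proof -
  obtain z u v where z: "zero_object C z" "u \<in> hom C a z" "v \<in> hom C z b" "f = v \<cdot> u"
    using zero_arrE[OF assms(1,3)] .
  obtain z' u' v' where z': "zero_object C z'" "u' \<in> hom C a z'" "v' \<in> hom C z' b" "g = v' \<cdot> u'"
    using zero_arrE[OF assms(2,4)] .
  obtain w where w: "w \<in> hom C z z'"
    using z(1) hom_Obj[OF z'(3)] unfolding zero_object_def by (blast elim: initialE)
  have "v' \<cdot> w = v"
    using initial_unique z(1,3) comp_in[OF w z'(3)] unfolding zero_object_def by blast
  moreover have "w \<cdot> u = u'"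
    using terminal_unique z'(1,2) comp_in[OF z(2) w] unfolding zero_object_def by blast
  ultimately show ?thesis using assoc[OF z(2) w z'(3)] z(4) z'(4) by simp
qed

lemma zero_arr_exists:
  assumes "a \<in> Obj C" "b \<in> Obj C"
  shows "\<exists>f\<in>hom C a b. zero_arr C f"
proof -
  obtain z where z: "zero_object C z" using pointed unfolding pointed_def by blast
  obtain u v where uv: "u \<in> hom C a z" "v \<in> hom C z b"
    using terminalE initialE z assms unfolding zero_object_def by metis
  show ?thesis using zero_arrI[OF z uv] comp_in[OF uv] by (rule bexI)
qed

text \<open>Naming the unique zero morphism turns the existential predicate \<open>zero_arr\<close>
  into an equation that can be used for rewriting.\<close>

definition zero :: "'a \<Rightarrow> 'a \<Rightarrow> 'b" where
  "zero a b = (THE f. f \<in> hom C a b \<and> zero_arr C f)"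

lemma zero_props:
  assumes "a \<in> Obj C" "b \<in> Obj C"
  shows "zero a b \<in> hom C a b \<and> zero_arr C (zero a b)"
proof -
  obtain f where "f \<in> hom C a b" "zero_arr C f" using zero_arr_exists[OF assms] ..
  then have "\<exists>!f. f \<in> hom C a b \<and> zero_arr C f"
    by (intro ex1I[of _ f]) (auto intro: zero_arr_unique)
  then show ?thesis unfolding zero_def by (rule theI')
qed

lemmas zero_in = zero_props[THEN conjunct1]

lemma zero_arr_iff: "f \<in> hom C a b \<Longrightarrow> zero_arr C f \<longleftrightarrow> f = zero a b"
  using zero_props zero_arr_unique hom_Obj by metis

lemma zero_comp:
  assumes "f \<in> hom C a b" "c \<in> Obj C"
  shows "zero b c \<cdot> f = zero a c"
proof -
  have b: "b \<in> Obj C" using hom_Obj assms(1) by blast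
  note z = zero_in[OF b assms(2)]
  obtain t u v where t: "zero_object C t" "u \<in> hom C b t" "v \<in> hom C t c" "zero b c = v \<cdot> u"
    using zero_arrE[OF z] zero_props[OF b assms(2)] by blast
  have "zero b c \<cdot> f = v \<cdot> (u \<cdot> f)" using assoc[OF assms(1) t(2,3)] t(4) by simp
  then have "zero_arr C (zero b c \<cdot> f)"
    using zero_arrI[OF t(1) comp_in[OF assms(1) t(2)] t(3)] by simp
  then show ?thesis using zero_arr_iff[OF comp_in[OF assms(1) z]] by simp
qed

lemma comp_zero:
  assumes "f \<in> hom C b c" "a \<in> Obj C"
  shows "f \<cdot> zero a b = zero a c"
proof -
  have b: "b \<in> Obj C" using hom_Obj assms(1) by blast
  note z = zero_in[OF assms(2) b]
  obtain t u v where t: "zero_object C t" "u \<in> hom C a t" "v \<in> hom C t b" "zero a b = v \<cdot> u"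
    using zero_arrE[OF z] zero_props[OF assms(2) b] by blast
  have "f \<cdot> zero a b = (f \<cdot> v) \<cdot> u" using assoc[OF t(2,3) assms(1)] t(4) by simp
  then have "zero_arr C (f \<cdot> zero a b)"
    using zero_arrI[OF t(1,2) comp_in[OF t(3) assms(1)]] by simp
  then show ?thesis using zero_arr_iff[OF comp_in[OF z assms(1)]] by simp
qed

lemma into_zero_object:
  assumes "terminal C z" "f \<in> hom C a z"
  shows "f = zero a z"
  by (rule terminal_unique[OF assms]) (use hom_Obj[OF assms(2)] zero_in in simp)

lemma from_zero_object:
  assumes "initial C z" "f \<in> hom C z a"
  shows "f = zero z a"
  by (rule initial_unique[OF assms]) (use hom_Obj[OF assms(2)] zero_in in simp)

text \<open>Every morphism into or out of \<open>a\<close> equals its composite with the identity of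
  \<open>a\<close>, hence is zero.\<close>

lemma Idn_zero_imp_zero_object:
  assumes "a \<in> Obj C" "Idn C a = zero a a"
  shows "zero_object C a"
proof -
  have "f = zero e a" if "f \<in> hom C e a" for e f
    using Idn_left[OF that] zero_comp[OF that assms(1)] assms(2) by simp
  moreover have "f = zero a e" if "f \<in> hom C a e" for e f
    using Idn_right[OF that] comp_zero[OF that assms(1)] assms(2) by simp
  ultimately show ?thesis
    using assms(1) zero_in unfolding zero_object_def initial_def terminal_def by metis
qed

text \<open>The identity of a terminal object coincides with its zero endomorphism. This lets
  terminality of a kernel object be read as vanishing of the kernel.\<close>

lemma terminal_iff_zero_object: "terminal C a \<longleftrightarrow> zero_object C a"
proof
  assume t: "terminal C a"
  then have "a \<in> Obj C" by (simp add: terminal_def)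
  then show "zero_object C a"
    using Idn_zero_imp_zero_object into_zero_object[OF t] Idn_in by blast
qed (simp add: zero_object_def)

lemma is_kernel_iff:
  assumes "f \<in> hom C a b"
  shows "is_kernel C f k \<longleftrightarrow> (\<exists>K. k \<in> hom C K a \<and> f \<cdot> k = zero K b \<and>
    (\<forall>e. \<forall>g\<in>hom C e a. f \<cdot> g = zero e b \<longrightarrow> (\<exists>!h. h \<in> hom C e K \<and> k \<cdot> h = g)))"
proof -
  have z: "zero_arr C (f \<cdot> g) \<longleftrightarrow> f \<cdot> g = zero e b" if "g \<in> hom C e a" for e g
    using zero_arr_iff[OF comp_in[OF that assms]] .
  note fD = Dom_hom[OF assms]
  show ?thesis
  proof
    assume k: "is_kernel C f k"
    then have "k \<in> hom C (Dom C k) a" unfolding is_kernel_def hom_def fD by simp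
    moreover have "\<exists>!h. h \<in> hom C e (Dom C k) \<and> k \<cdot> h = g"
      if g: "g \<in> hom C e a" "f \<cdot> g = zero e b" for e g
    proof -
      have "\<forall>g\<in>Arr C. Cod C g = a \<and> zero_arr C (f \<cdot> g) \<longrightarrow>
          (\<exists>!h. h \<in> hom C (Dom C g) (Dom C k) \<and> k \<cdot> h = g)"
        using k unfolding is_kernel_def fD by (elim conjE)
      from bspec[OF this ArrI[OF g(1)]] show ?thesis
        using Dom_hom[OF g(1)] Cod_hom[OF g(1)] z[OF g(1)] g(2) by simp
    qed
    ultimately show "\<exists>K. k \<in> hom C K a \<and> f \<cdot> k = zero K b \<and>
        (\<forall>e. \<forall>g\<in>hom C e a. f \<cdot> g = zero e b \<longrightarrow> (\<exists>!h. h \<in> hom C e K \<and> k \<cdot> h = g))"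
      using k z unfolding is_kernel_def by blast
  next
    assume "\<exists>K. k \<in> hom C K a \<and> f \<cdot> k = zero K b \<and>
        (\<forall>e. \<forall>g\<in>hom C e a. f \<cdot> g = zero e b \<longrightarrow> (\<exists>!h. h \<in> hom C e K \<and> k \<cdot> h = g))"
    then obtain K where k: "k \<in> hom C K a" "f \<cdot> k = zero K b"
      and u: "\<And>e g. g \<in> hom C e a \<Longrightarrow> f \<cdot> g = zero e b \<Longrightarrow> \<exists>!h. h \<in> hom C e K \<and> k \<cdot> h = g"
      by blast
    show "is_kernel C f k"
      unfolding is_kernel_def fD Dom_hom[OF k(1)] Cod_hom[OF k(1)] z[OF k(1)]
    proof (intro conjI ballI impI)
      fix g assume "g \<in> Arr C" "Cod C g = a \<and> zero_arr C (f \<cdot> g)"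
      moreover from this have "g \<in> hom C (Dom C g) a" unfolding hom_def by simp
      ultimately show "\<exists>!h. h \<in> hom C (Dom C g) K \<and> k \<cdot> h = g" using u z by simp
    qed (use k ArrI in auto)
  qed
qed

text \<open>A choice-free form of "the kernel is 0": it mentions no kernel object and makes sense
  before kernels are known to exist.\<close>

definition trivial_kernel :: "'b \<Rightarrow> bool" where
  "trivial_kernel f \<longleftrightarrow>
    (\<forall>e. \<forall>g\<in>hom C e (Dom C f). f \<cdot> g = zero e (Cod C f) \<longrightarrow> g = zero e (Dom C f))"

lemma trivial_kernel_iff:
  "f \<in> hom C a b \<Longrightarrow>
    trivial_kernel f \<longleftrightarrow> (\<forall>e. \<forall>g\<in>hom C e a. f \<cdot> g = zero e b \<longrightarrow> g = zero e a)"
  unfolding trivial_kernel_def using Dom_hom Cod_hom by metis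

lemma mono_trivial_kernel:
  assumes "f \<in> Arr C" "mono_arr C f"
  shows "trivial_kernel f"
  unfolding trivial_kernel_def
  using assms mono_arr_iff[OF Arr_in_hom[OF assms(1)]] comp_zero[OF Arr_in_hom[OF assms(1)]]
    hom_Obj zero_in by metis

text \<open>The hypothesis \<open>ex\<close> is what gives the \<open>SOME\<close> in
  \<open>kernel\<close> a meaning. If the kernel object is zero, everything killed by
  \<open>f\<close> factors through zero; conversely the kernel morphism is itself killed by
  \<open>f\<close>.\<close>

lemma kernel_is_zero_iff:
  assumes f: "f \<in> hom C a b" and ex: "is_kernel C f k0"
  shows "kernel_is_zero C f \<longleftrightarrow> trivial_kernel f"
proof -
  have "is_kernel C f (kernel C f)" unfolding kernel_def using ex by (rule someI)
  then obtain K where k: "kernel C f \<in> hom C K a" "f \<cdot> kernel C f = zero K b"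
    and univ: "\<And>e g. g \<in> hom C e a \<Longrightarrow> f \<cdot> g = zero e b \<Longrightarrow>
      \<exists>!h. h \<in> hom C e K \<and> kernel C f \<cdot> h = g"
    unfolding is_kernel_iff[OF f] by blast
  have K: "K \<in> Obj C" and a: "a \<in> Obj C" using hom_Obj k by blast+
  have z: "kernel_is_zero C f \<longleftrightarrow> zero_object C K"
    unfolding kernel_is_zero_def using Dom_hom k by simp
  show ?thesis unfolding z trivial_kernel_iff[OF f]
  proof (intro iffI allI ballI impI)
    fix e g assume K0: "zero_object C K" and g: "g \<in> hom C e a" "f \<cdot> g = zero e b"
    then obtain h where h: "h \<in> hom C e K" "kernel C f \<cdot> h = g" using univ by blast
    have "kernel C f = zero K a"
      using from_zero_object k(1) K0 unfolding zero_object_def by blast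
    then show "g = zero e a" using zero_comp[OF h(1) a] h by simp
  next
    assume tr: "\<forall>e. \<forall>g\<in>hom C e a. f \<cdot> g = zero e b \<longrightarrow> g = zero e a"
    \<comment> \<open>The kernel morphism is zero, so both \<open>Idn C K\<close> and
      \<open>zero K K\<close> factor it through itself; uniqueness of the factorization identifies
      them.\<close>
    have "kernel C f \<cdot> zero K K = zero K a" using comp_zero[OF k(1) K] .
    moreover have "kernel C f = zero K a" using tr k by blast
    ultimately have "Idn C K = zero K K"
      using univ[OF k] Idn_right[OF k(1)] Idn_in[OF K] zero_in[OF K K] by metis
    then show "zero_object C K" using Idn_zero_imp_zero_object K by blast
  qed
qed

end

section \<open>Pullbacks and kernels obtained from finite limits\<close>

locale pointed_fc_cat = pointed_cat +
  assumes finitely_complete: "finitely_complete C"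
begin

lemma pullback_exists:
  assumes f: "f \<in> hom C a c" and g: "g \<in> hom C b c"
  shows "\<exists>pq. is_pullback C f g pq"
proof -
  \<comment> \<open>The cospan shape: 0, 1, 2 are the vertices and also their identities, 3 is the
    arrow from 0 to 2 and 4 the arrow from 1 to 2. In a composable pair one factor is always an
    identity, so the composite is the other factor.\<close>
  define J :: "(nat, nat) cat" where
    "J = \<lparr>Obj = {0,1,2}, Arr = {0,1,2,3,4},
      Dom = (\<lambda>j. if j = 3 then 0 else if j = 4 then 1 else j), Cod = (\<lambda>j. if j < 3 then j else 2),
      Idn = (\<lambda>j. j), Comp = (\<lambda>v u. if v < 3 then u else v)\<rparr>"
  define F :: "(nat, nat, 'a, 'b) ftor" where
    "F = \<lparr>Src = J, Tgt = C, OMap = (\<lambda>j. if j = 0 then a else if j = 1 then b else c),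
      AMap = (\<lambda>j. if j = 0 then Idn C a else if j = 1 then Idn C b else if j = 2 then Idn C c
        else if j = 3 then f else g)\<rparr>"
  have o: "a \<in> Obj C" "b \<in> Obj C" "c \<in> Obj C" using hom_Obj f g by blast+
  note id = Idn_in[OF o(1)] Idn_in[OF o(2)] Idn_in[OF o(3)]
  have J: "category J" unfolding category_def J_def hom_def by simp
  have F: "is_functor F"
    unfolding is_functor_def F_def using J category
    by (simp add: J_def f g o id Idn_left[OF f] Idn_left[OF g] Idn_right[OF f] Idn_right[OF g]
        id[THEN Idn_left])
  have FJ: "Src F = J" "Tgt F = C" "Obj J = {0,1,2}" by (simp_all add: F_def J_def)
  have "\<exists>L \<pi>. is_limit F L \<pi>"
    using finitely_complete F unfolding finitely_complete_def by (simp add: F_def J_def)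
  then obtain L \<pi> where lim: "is_limit F L \<pi>" by blast
  \<comment> \<open>The leg at vertex 2 is determined by either of the others, so a cone amounts to
    a commuting square.\<close>
  have cone: "is_cone F M \<mu> \<longleftrightarrow> \<mu> 0 \<in> hom C M a \<and> \<mu> 1 \<in> hom C M b \<and>
      f \<cdot> \<mu> 0 = \<mu> 2 \<and> g \<cdot> \<mu> 1 = \<mu> 2" for M \<mu>
  proof -
    have "\<mu> 2 \<in> hom C M c" if "\<mu> 0 \<in> hom C M a" "f \<cdot> \<mu> 0 = \<mu> 2"
      using comp_in[OF that(1) f] that(2) by simp
    then show ?thesis
      unfolding is_cone_def F_def using hom_Obj by (auto simp: J_def Idn_left)
  qed
  have L: "\<pi> 0 \<in> hom C L a" "\<pi> 1 \<in> hom C L b" "f \<cdot> \<pi> 0 = g \<cdot> \<pi> 1" "\<pi> 2 = f \<cdot> \<pi> 0"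
    using lim cone unfolding is_limit_def by auto
  have univ: "\<exists>!h. h \<in> hom C e L \<and> \<pi> 0 \<cdot> h = x \<and> \<pi> 1 \<cdot> h = y"
    if x: "x \<in> hom C e a" and y: "y \<in> hom C e b" and xy: "f \<cdot> x = g \<cdot> y" for e x y
  proof -
    let ?m = "\<lambda>j::nat. if j = 0 then x else if j = 1 then y else f \<cdot> x"
    have "is_cone F e ?m" unfolding cone using x y xy by simp
    moreover have "\<forall>M \<mu>. is_cone F M \<mu> \<longrightarrow>
        (\<exists>!h. h \<in> hom C M L \<and> (\<forall>j\<in>{0,1,2}. \<pi> j \<cdot> h = \<mu> j))"
      using lim unfolding is_limit_def FJ by (elim conjE)
    ultimately have "\<exists>!h. h \<in> hom C e L \<and> (\<forall>j\<in>{0,1,2}. \<pi> j \<cdot> h = ?m j)"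
      by blast
    \<comment> \<open>The condition at vertex 2 follows from that at 0 because
      \<open>\<pi> 2 = f \<cdot> \<pi> 0\<close>; cone factorizations are thus the same as pair
      factorizations.\<close>
    moreover have "\<pi> 2 \<cdot> h = f \<cdot> x" if "h \<in> hom C e L" "\<pi> 0 \<cdot> h = x" for h
      using assoc[OF that(1) L(1) f] L(4) that(2) by simp
    then have "h \<in> hom C e L \<and> (\<forall>j\<in>{0,1,2}. \<pi> j \<cdot> h = ?m j) \<longleftrightarrow>
        h \<in> hom C e L \<and> \<pi> 0 \<cdot> h = x \<and> \<pi> 1 \<cdot> h = y" for h
      by auto
    ultimately show ?thesis by simp
  qed
  have "is_pullback C f g (\<pi> 0, \<pi> 1)"
    unfolding is_pullback_def prod.case
  proof (intro conjI ballI impI)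
    fix x y assume "x \<in> Arr C" "y \<in> Arr C"
      "Dom C x = Dom C y \<and> Cod C x = Dom C f \<and> Cod C y = Dom C g \<and> f \<cdot> x = g \<cdot> y"
    then have "x \<in> hom C (Dom C x) a" "y \<in> hom C (Dom C x) b" "f \<cdot> x = g \<cdot> y"
      using f g unfolding hom_def by auto
    from univ[OF this]
    show "\<exists>!h. h \<in> hom C (Dom C x) (Dom C (\<pi> 0)) \<and> \<pi> 0 \<cdot> h = x \<and> \<pi> 1 \<cdot> h = y"
      using Dom_hom[OF L(1)] by simp
  qed (use L f g in \<open>auto simp: hom_def\<close>)
  then show ?thesis by blast
qed

context
  fixes f g a b c
  assumes f: "f \<in> hom C a c" and g: "g \<in> hom C b c"
begin

lemma is_pullback_proj: "is_pullback C f g (proj1 C f g, proj2 C f g)"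
  using someI_ex[OF pullback_exists[OF f g]] unfolding proj1_def proj2_def pullback_def by simp

lemma proj1_in: "proj1 C f g \<in> hom C (pb_obj C f g) a"
  and proj2_in: "proj2 C f g \<in> hom C (pb_obj C f g) b"
  and proj_comm: "f \<cdot> proj1 C f g = g \<cdot> proj2 C f g"
  using is_pullback_proj f g unfolding is_pullback_def pb_obj_def hom_def by auto

lemma pb_univ:
  assumes "x \<in> hom C e a" "y \<in> hom C e b" "f \<cdot> x = g \<cdot> y"
  shows "\<exists>!h. h \<in> hom C e (pb_obj C f g) \<and> proj1 C f g \<cdot> h = x \<and> proj2 C f g \<cdot> h = y"
proof -
  have "\<forall>x\<in>Arr C. \<forall>y\<in>Arr C. Dom C x = Dom C y \<and> Cod C x = Dom C f \<and> Cod C y = Dom C g \<and>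
      f \<cdot> x = g \<cdot> y \<longrightarrow>
      (\<exists>!h. h \<in> hom C (Dom C x) (pb_obj C f g) \<and> proj1 C f g \<cdot> h = x \<and> proj2 C f g \<cdot> h = y)"
    using is_pullback_proj unfolding is_pullback_def prod.case pb_obj_def by (elim conjE)
  from bspec[OF bspec[OF this ArrI[OF assms(1)]] ArrI[OF assms(2)]] show ?thesis
    using assms Dom_hom Cod_hom f g by simp
qed

lemma pb_pair_props:
  assumes "x \<in> hom C e a" "y \<in> hom C e b" "f \<cdot> x = g \<cdot> y"
  shows "pb_pair C f g x y \<in> hom C e (pb_obj C f g) \<and>
    proj1 C f g \<cdot> pb_pair C f g x y = x \<and> proj2 C f g \<cdot> pb_pair C f g x y = y"
  unfolding pb_pair_def Dom_hom[OF assms(1)] by (rule theI'[OF pb_univ[OF assms]])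

lemmas proj1_pair = pb_pair_props[THEN conjunct2, THEN conjunct1]
  and proj2_pair = pb_pair_props[THEN conjunct2, THEN conjunct2]

lemma pb_ext:
  assumes "u \<in> hom C e (pb_obj C f g)" "v \<in> hom C e (pb_obj C f g)"
    "proj1 C f g \<cdot> u = proj1 C f g \<cdot> v" "proj2 C f g \<cdot> u = proj2 C f g \<cdot> v"
  shows "u = v"
proof -
  have "f \<cdot> (proj1 C f g \<cdot> u) = g \<cdot> (proj2 C f g \<cdot> u)"
    using assoc[OF assms(1) proj1_in f] assoc[OF assms(1) proj2_in g] proj_comm by simp
  with pb_univ[OF comp_in[OF assms(1) proj1_in] comp_in[OF assms(1) proj2_in]] assms
  show ?thesis by metis
qed

end

text \<open>The kernel is the pullback of \<open>f\<close> along the morphism from a zero object to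
  \<open>b\<close>.\<close>

lemma kernel_exists:
  assumes f: "f \<in> hom C a b"
  shows "\<exists>k. is_kernel C f k"
proof -
  obtain z where z: "initial C z" "terminal C z"
    using pointed unfolding pointed_def zero_object_def by blast
  have o: "a \<in> Obj C" "b \<in> Obj C" "z \<in> Obj C"
    using hom_Obj[OF f] z(1) unfolding initial_def by auto
  let ?z = "zero z b"
  note zb = zero_in[OF o(3,2)]
  let ?p = "proj1 C f ?z" and ?q = "proj2 C f ?z"
  note p = proj1_in[OF f zb] and q = proj2_in[OF f zb]
  have "f \<cdot> ?p = zero (pb_obj C f ?z) b"
    using proj_comm[OF f zb] zero_comp[OF q o(2)] by simp
  moreover have "\<exists>!h. h \<in> hom C e (pb_obj C f ?z) \<and> ?p \<cdot> h = g"
    if g: "g \<in> hom C e a" "f \<cdot> g = zero e b" for e g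
  proof -
    have e: "e \<in> Obj C" using hom_Obj g by blast
    have "f \<cdot> g = ?z \<cdot> zero e z" using g(2) zero_comp[OF zero_in[OF e o(3)] o(2)] by simp
    from pb_univ[OF f zb g(1) zero_in[OF e o(3)] this]
    \<comment> \<open>The component into the zero object is forced, so uniqueness for the pair is
      uniqueness for the component into \<open>a\<close> alone.\<close>
    show ?thesis using into_zero_object[OF z(2) comp_in[OF _ q]] by blast
  qed
  ultimately show ?thesis unfolding is_kernel_iff[OF f] using p by blast
qed

lemma kernel_is_zero_trivial: "f \<in> Arr C \<Longrightarrow> kernel_is_zero C f \<longleftrightarrow> trivial_kernel f"
  using kernel_exists[OF Arr_in_hom] kernel_is_zero_iff[OF Arr_in_hom] by blast

lemma kernel_props:
  assumes f: "f \<in> hom C a b"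
  shows "kernel C f \<in> hom C (Dom C (kernel C f)) a"
    and "f \<cdot> kernel C f = zero (Dom C (kernel C f)) b"
    and "\<And>e g. g \<in> hom C e a \<Longrightarrow> f \<cdot> g = zero e b \<Longrightarrow>
      \<exists>!h. h \<in> hom C e (Dom C (kernel C f)) \<and> kernel C f \<cdot> h = g"
proof -
  have "is_kernel C f (kernel C f)" unfolding kernel_def using kernel_exists[OF f] by (rule someI_ex)
  then obtain K where "kernel C f \<in> hom C K a" "f \<cdot> kernel C f = zero K b"
    "\<And>e g. g \<in> hom C e a \<Longrightarrow> f \<cdot> g = zero e b \<Longrightarrow> \<exists>!h. h \<in> hom C e K \<and> kernel C f \<cdot> h = g"
    unfolding is_kernel_iff[OF f] by blast
  moreover from this have "K = Dom C (kernel C f)" using Dom_hom by blast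
  ultimately show "kernel C f \<in> hom C (Dom C (kernel C f)) a"
    and "f \<cdot> kernel C f = zero (Dom C (kernel C f)) b"
    and "\<And>e g. g \<in> hom C e a \<Longrightarrow> f \<cdot> g = zero e b \<Longrightarrow>
      \<exists>!h. h \<in> hom C e (Dom C (kernel C f)) \<and> kernel C f \<cdot> h = g" by auto
qed

lemma zero_objectE:
  obtains z where "zero_object C z" "initial C z" "terminal C z" "z \<in> Obj C"
  using pointed unfolding pointed_def zero_object_def initial_def by blast

text \<open>Any \<open>g\<close>, \<open>h\<close> with \<open>f \<cdot> g = f \<cdot> h\<close> are
  the two components of one morphism into the kernel pair.\<close>

lemma mono_if_proj_eq:
  assumes f: "f \<in> hom C a b" and eq: "proj1 C f f = proj2 C f f"
  shows "mono_arr C f"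
  unfolding mono_arr_iff[OF f]
proof (intro allI ballI impI)
  fix e g h assume "g \<in> hom C e a" "h \<in> hom C e a" "f \<cdot> g = f \<cdot> h"
  from proj1_pair[OF f f this] proj2_pair[OF f f this] show "g = h" using eq by simp
qed

text \<open>The diagonal \<open>d\<close> splits both kernel pair projections. Once the first
  projection is mono, \<open>d\<close> is its inverse, and the two projections, sharing the section
  \<open>d\<close>, must agree.\<close>

lemma trivial_kernel_mono:
  assumes f: "f \<in> hom C a b" and tr: "trivial_kernel f"
    and split: "\<And>A \<alpha> \<beta> B. \<alpha> \<in> hom C A B \<Longrightarrow> \<beta> \<in> hom C B A \<Longrightarrow> \<alpha> \<cdot> \<beta> = Idn C B \<Longrightarrow>
      trivial_kernel \<alpha> \<Longrightarrow> mono_arr C \<alpha>"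
  shows "mono_arr C f"
proof -
  let ?K = "pb_obj C f f" and ?p = "proj1 C f f" and ?q = "proj2 C f f"
  note p = proj1_in[OF f f] and q = proj2_in[OF f f]
  have a: "a \<in> Obj C" and b: "b \<in> Obj C" and K: "?K \<in> Obj C" using hom_Obj f p by blast+
  define d where "d = pb_pair C f f (Idn C a) (Idn C a)"
  have d: "d \<in> hom C a ?K" and pd: "?p \<cdot> d = Idn C a" and qd: "?q \<cdot> d = Idn C a"
    using pb_pair_props[OF f f Idn_in[OF a] Idn_in[OF a] refl] unfolding d_def by auto
  \<comment> \<open>A morphism killed by \<open>?p\<close> is a pair of 0 and some \<open>k\<close>
    with \<open>f \<cdot> k = 0\<close>, and \<open>tr\<close> makes \<open>k\<close> zero
    too.\<close>
  have "trivial_kernel ?p" unfolding trivial_kernel_iff[OF p]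
  proof (intro allI ballI impI)
    fix e g assume g: "g \<in> hom C e ?K" and pg: "?p \<cdot> g = zero e a"
    have e: "e \<in> Obj C" using hom_Obj[OF g] by blast
    have "f \<cdot> (?q \<cdot> g) = f \<cdot> (?p \<cdot> g)"
      using assoc[OF g p f] assoc[OF g q f] proj_comm[OF f f] by simp
    then have "?q \<cdot> g = zero e a"
      using tr comp_in[OF g q] comp_zero[OF f e] pg unfolding trivial_kernel_iff[OF f] by simp
    then show "g = zero e ?K"
      using pb_ext[OF f f g zero_in[OF e K]] pg comp_zero[OF p e] comp_zero[OF q e] by simp
  qed
  then have "mono_arr C ?p" by (rule split[OF p d pd])
  moreover have "?p \<cdot> (d \<cdot> ?p) = ?p \<cdot> Idn C ?K"
    using assoc[OF p d p] pd Idn_left[OF p] Idn_right[OF p] by simp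
  ultimately have dp: "d \<cdot> ?p = Idn C ?K"
    using comp_in[OF p d] Idn_in[OF K] unfolding mono_arr_iff[OF p] by blast
  \<comment> \<open>\<open>?q = ?q \<cdot> (d \<cdot> ?p) = (?q \<cdot> d) \<cdot> ?p =
    ?p\<close>.\<close>
  have qp: "?q = ?p"
    using assoc[OF p d q] qd dp Idn_left[OF p] Idn_right[OF q] by simp
  then show ?thesis by (intro mono_if_proj_eq[OF f]) simp
qed

lemma kernel_mono:
  assumes f: "f \<in> hom C a b"
    and "g \<in> hom C e (Dom C (kernel C f))" "h \<in> hom C e (Dom C (kernel C f))"
    and "kernel C f \<cdot> g = kernel C f \<cdot> h"
  shows "g = h"
proof -
  note k = kernel_props[OF f]
  have b: "b \<in> Obj C" using hom_Obj[OF f] by blast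
  have "f \<cdot> (kernel C f \<cdot> g) = zero e b"
    using assoc[OF assms(2) k(1) f] k(2) zero_comp[OF assms(2) b] by simp
  from k(3)[OF comp_in[OF assms(2) k(1)] this] show ?thesis using assms by metis
qed

lemma terminal_kernel_iff:
  assumes "f \<in> hom C a b"
  shows "terminal C (Dom C (kernel C f)) \<longleftrightarrow> trivial_kernel f"
  using kernel_is_zero_trivial[OF ArrI[OF assms]]
  unfolding kernel_is_zero_def terminal_iff_zero_object .

end

section \<open>The category of points\<close>

lemma Pt_sel:
  "Obj (Pt X B) = points X B"
  "Dom (Pt X B) (S, f, T) = S"
  "Cod (Pt X B) (S, f, T) = T"
  "Idn (Pt X B) (A, \<alpha>, \<beta>) = ((A, \<alpha>, \<beta>), Idn X A, (A, \<alpha>, \<beta>))"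
  "(S', g, T') \<cdot>\<^bsub>Pt X B\<^esub> (S, f, T) = (S, g \<cdot>\<^bsub>X\<^esub> f, T')"
  by (simp_all add: Pt_def)

text \<open>Written with \<open>fst\<close> and \<open>snd\<close> so that it applies to points held
  in variables; \<open>pt_map_simp\<close> recovers the triple form.\<close>

definition pt_map :: "('o, 'm) cat \<Rightarrow> 'm \<Rightarrow> ('o, 'm) point \<Rightarrow> ('o, 'm) point \<Rightarrow> bool" where
  "pt_map X f S T \<longleftrightarrow> f \<in> hom X (fst S) (fst T) \<and>
    fst (snd T) \<cdot>\<^bsub>X\<^esub> f = fst (snd S) \<and> f \<cdot>\<^bsub>X\<^esub> snd (snd S) = snd (snd T)"

lemma pt_map_simp:
  "pt_map X f (A, \<alpha>, \<beta>) (A', \<alpha>', \<beta>') \<longleftrightarrow> f \<in> hom X A A' \<and> \<alpha>' \<cdot>\<^bsub>X\<^esub> f = \<alpha> \<and> f \<cdot>\<^bsub>X\<^esub> \<beta> = \<beta>'"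
  by (simp add: pt_map_def)

lemma Pt_Arr_iff:
  "(S, f, T) \<in> Arr (Pt X B) \<longleftrightarrow> S \<in> points X B \<and> T \<in> points X B \<and> pt_map X f S T"
  by (cases S; cases T) (simp add: Pt_def pt_map_def)

lemma Pt_hom_iff:
  "F \<in> hom (Pt X B) S T \<longleftrightarrow>
    (\<exists>f. F = (S, f, T) \<and> S \<in> points X B \<and> T \<in> points X B \<and> pt_map X f S T)"
  by (cases F) (auto simp: hom_def Pt_Arr_iff Pt_sel)

lemma points_iff:
  "(A, \<alpha>, \<beta>) \<in> points X B \<longleftrightarrow>
    A \<in> Obj X \<and> \<alpha> \<in> hom X A B \<and> \<beta> \<in> hom X B A \<and> \<alpha> \<cdot>\<^bsub>X\<^esub> \<beta> = Idn X B"
  by (simp add: points_def)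

context cat
begin

lemma pointsI:
  "\<alpha> \<in> hom C A B \<Longrightarrow> \<beta> \<in> hom C B A \<Longrightarrow> \<alpha> \<cdot> \<beta> = Idn C B \<Longrightarrow> (A, \<alpha>, \<beta>) \<in> points C B"
  unfolding points_iff using hom_Obj by blast

lemma pt_map_comp:
  assumes "S \<in> points C B" "T \<in> points C B" "U \<in> points C B" "pt_map C f S T" "pt_map C g T U"
  shows "pt_map C (g \<cdot> f) S U"
proof -
  obtain A \<alpha> \<beta> A' \<alpha>' \<beta>' A'' \<alpha>'' \<beta>'' where
    S: "S = (A, \<alpha>, \<beta>)" "T = (A', \<alpha>', \<beta>')" "U = (A'', \<alpha>'', \<beta>'')"
    by (metis prod_cases3)
  have "f \<in> hom C A A'" "g \<in> hom C A' A''" "\<beta> \<in> hom C B A" "\<alpha>'' \<in> hom C A'' B"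
    "\<alpha>' \<cdot> f = \<alpha>" "f \<cdot> \<beta> = \<beta>'" "\<alpha>'' \<cdot> g = \<alpha>'" "g \<cdot> \<beta>' = \<beta>''"
    using assms unfolding S pt_map_simp points_iff by auto
  then show ?thesis
    unfolding S pt_map_simp using comp_in assoc[of f A A' g A'' \<alpha>'' B] assoc[of \<beta> B A f A' g A'']
    by simp
qed

lemma pt_map_Idn:
  assumes "(A, \<alpha>, \<beta>) \<in> points C B"
  shows "pt_map C (Idn C A) (A, \<alpha>, \<beta>) (A, \<alpha>, \<beta>)"
  using assms unfolding pt_map_simp points_iff by (blast intro: Idn_in Idn_left Idn_right)

lemma category_Pt: "category (Pt C B)"
  unfolding category_def
proof (intro conjI ballI impI)
  fix F assume "F \<in> Arr (Pt C B)"
  then obtain S f T where F: "F = (S, f, T)" "S \<in> points C B" "T \<in> points C B" "pt_map C f S T"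
    by (cases F) (auto simp: Pt_Arr_iff)
  obtain A \<alpha> \<beta> A' \<alpha>' \<beta>' where ST: "S = (A, \<alpha>, \<beta>)" "T = (A', \<alpha>', \<beta>')" by (metis prod_cases3)
  show "Dom (Pt C B) F \<in> Obj (Pt C B)" "Cod (Pt C B) F \<in> Obj (Pt C B)"
    using F by (simp_all add: Pt_sel)
  show "F \<cdot>\<^bsub>Pt C B\<^esub> Idn (Pt C B) (Dom (Pt C B) F) = F"
    "Idn (Pt C B) (Cod (Pt C B) F) \<cdot>\<^bsub>Pt C B\<^esub> F = F"
    using F(4) Idn_left[of f A A'] Idn_right[of f A A'] unfolding F(1) ST
    by (simp_all add: Pt_sel pt_map_simp)
next
  fix S assume S: "S \<in> Obj (Pt C B)"
  obtain A \<alpha> \<beta> where "S = (A, \<alpha>, \<beta>)" by (metis prod_cases3)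
  with S show "Idn (Pt C B) S \<in> hom (Pt C B) S S"
    using pt_map_Idn by (simp add: Pt_sel Pt_hom_iff)
next
  fix F G assume "F \<in> Arr (Pt C B)" "G \<in> Arr (Pt C B)" "Cod (Pt C B) F = Dom (Pt C B) G"
  then show "G \<cdot>\<^bsub>Pt C B\<^esub> F \<in> hom (Pt C B) (Dom (Pt C B) F) (Cod (Pt C B) G)"
    by (cases F; cases G) (auto simp: Pt_Arr_iff Pt_sel Pt_hom_iff intro: pt_map_comp)
next
  fix F G H
  assume "F \<in> Arr (Pt C B)" "G \<in> Arr (Pt C B)" "H \<in> Arr (Pt C B)"
    "Cod (Pt C B) F = Dom (Pt C B) G" "Cod (Pt C B) G = Dom (Pt C B) H"
  then show "(H \<cdot>\<^bsub>Pt C B\<^esub> G) \<cdot>\<^bsub>Pt C B\<^esub> F = H \<cdot>\<^bsub>Pt C B\<^esub> (G \<cdot>\<^bsub>Pt C B\<^esub> F)"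
    by (cases F; cases G; cases H) (auto simp: Pt_Arr_iff Pt_sel pt_map_def intro: assoc)
qed

lemma Idn_point: "B \<in> Obj C \<Longrightarrow> (B, Idn C B, Idn C B) \<in> points C B"
  using Idn_in Idn_left by (intro pointsI) auto

lemma pt_map_retraction:
  assumes "(A, \<alpha>, \<beta>) \<in> points C B"
  shows "pt_map C \<alpha> (A, \<alpha>, \<beta>) (B, Idn C B, Idn C B)"
  using assms Idn_left unfolding pt_map_simp points_iff by auto

lemma zero_object_Pt:
  assumes "B \<in> Obj C"
  shows "zero_object (Pt C B) (B, Idn C B, Idn C B)"
proof -
  let ?z = "(B, Idn C B, Idn C B)"
  have "\<exists>!F. F \<in> hom (Pt C B) S ?z" and "\<exists>!F. F \<in> hom (Pt C B) ?z S"
    if S: "S \<in> points C B" for S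
  proof -
    obtain A \<alpha> \<beta> where A: "S = (A, \<alpha>, \<beta>)" by (metis prod_cases3)
    have "\<alpha> \<in> hom C A B" "\<beta> \<in> hom C B A" "\<alpha> \<cdot> \<beta> = Idn C B"
      using S unfolding A points_iff by auto
    \<comment> \<open>One of the two triangles has an identity side and fixes \<open>f\<close>; the
      other then reads \<open>\<alpha> \<cdot> \<beta> = Idn C B\<close>.\<close>
    then have "pt_map C f S ?z \<longleftrightarrow> f = \<alpha>" "pt_map C f ?z S \<longleftrightarrow> f = \<beta>" for f
      using Idn_left Idn_right unfolding A pt_map_simp by auto
    then show "\<exists>!F. F \<in> hom (Pt C B) S ?z" "\<exists>!F. F \<in> hom (Pt C B) ?z S"
      using S Idn_point[OF assms] unfolding Pt_hom_iff by auto
  qed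
  then show ?thesis
    using Idn_point[OF assms] unfolding zero_object_def initial_def terminal_def Pt_sel by blast
qed

lemma pointed_cat_Pt: "B \<in> Obj C \<Longrightarrow> pointed_cat (Pt C B)"
  by unfold_locales (use category_Pt zero_object_Pt in \<open>unfold pointed_def, blast+\<close>)

text \<open>Here \<alpha> is invertible with inverse \<beta>, so a map of points from a point with
  retraction \<gamma> can only be \<open>\<beta> \<cdot> \<gamma>\<close>.\<close>

lemma iso_imp_terminal_point:
  assumes S: "(A, \<alpha>, \<beta>) \<in> points C B"
    and id: "\<beta> \<cdot> \<alpha> = Idn C A"
  shows "terminal (Pt C B) (A, \<alpha>, \<beta>)"
proof -
  have a: "\<alpha> \<in> hom C A B" "\<beta> \<in> hom C B A" "\<alpha> \<cdot> \<beta> = Idn C B" using S unfolding points_iff by auto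
  have "\<exists>!F. F \<in> hom (Pt C B) T (A, \<alpha>, \<beta>)" if T: "T \<in> points C B" for T
  proof -
    obtain D \<gamma> \<delta> where D: "T = (D, \<gamma>, \<delta>)" by (metis prod_cases3)
    have g: "\<gamma> \<in> hom C D B" "\<delta> \<in> hom C B D" "\<gamma> \<cdot> \<delta> = Idn C B"
      using T unfolding D points_iff by auto
    have "f = \<beta> \<cdot> \<gamma>" if "pt_map C f T (A, \<alpha>, \<beta>)" for f
      using that assoc[of f D A \<alpha> B \<beta> A] a id Idn_left unfolding D pt_map_simp by auto
    moreover have "pt_map C (\<beta> \<cdot> \<gamma>) T (A, \<alpha>, \<beta>)"
      using comp_in[OF g(1) a(2)] assoc[OF g(1) a(2,1)] assoc[OF g(2,1) a(2)] a g
        Idn_left[OF g(1)] Idn_right[OF a(2)]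
      unfolding D pt_map_simp by simp
    ultimately show ?thesis using S T unfolding Pt_hom_iff by blast
  qed
  then show ?thesis using S unfolding terminal_def Pt_sel by blast
qed

text \<open>Both \<open>\<beta> \<cdot> \<alpha>\<close> and the identity are endomorphisms of the
  point, and terminality allows only one.\<close>

lemma terminal_point_iff:
  assumes S: "(A, \<alpha>, \<beta>) \<in> points C B"
  shows "terminal (Pt C B) (A, \<alpha>, \<beta>) \<longleftrightarrow> \<beta> \<cdot> \<alpha> = Idn C A"
proof
  have a: "\<alpha> \<in> hom C A B" "\<beta> \<in> hom C B A" "\<alpha> \<cdot> \<beta> = Idn C B" using S unfolding points_iff by auto
  have "pt_map C (\<beta> \<cdot> \<alpha>) (A, \<alpha>, \<beta>) (A, \<alpha>, \<beta>)"
    using comp_in[OF a(1,2)] assoc[OF a(1,2,1)] assoc[OF a(2,1,2)] a(3)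
      Idn_left[OF a(1)] Idn_right[OF a(2)] unfolding pt_map_simp by simp
  moreover interpret P: cat "Pt C B" using category_Pt by unfold_locales
  assume "terminal (Pt C B) (A, \<alpha>, \<beta>)"
  ultimately have "((A, \<alpha>, \<beta>), \<beta> \<cdot> \<alpha>, (A, \<alpha>, \<beta>)) = ((A, \<alpha>, \<beta>), Idn C A, (A, \<alpha>, \<beta>))"
    using S pt_map_Idn[OF S] by (intro P.terminal_unique) (auto simp: Pt_hom_iff)
  then show "\<beta> \<cdot> \<alpha> = Idn C A" by simp
qed (rule iso_imp_terminal_point[OF S])

text \<open>A monic split epimorphism is invertible: cancel \<alpha> in
  \<open>\<alpha> \<cdot> (\<beta> \<cdot> \<alpha>) = \<alpha>\<close>.\<close>

lemma mono_retraction_iff: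
  assumes S: "(A, \<alpha>, \<beta>) \<in> points C B"
  shows "mono_arr C \<alpha> \<longleftrightarrow> \<beta> \<cdot> \<alpha> = Idn C A"
proof -
  have a: "\<alpha> \<in> hom C A B" "\<beta> \<in> hom C B A" "\<alpha> \<cdot> \<beta> = Idn C B" "A \<in> Obj C"
    using S unfolding points_iff by auto
  show ?thesis
  proof
    have "\<alpha> \<cdot> (\<beta> \<cdot> \<alpha>) = \<alpha> \<cdot> Idn C A"
      using assoc[OF a(1,2,1)] a(3) Idn_left[OF a(1)] Idn_right[OF a(1)] by simp
    moreover assume "mono_arr C \<alpha>"
    ultimately show "\<beta> \<cdot> \<alpha> = Idn C A"
      using comp_in[OF a(1,2)] Idn_in[OF a(4)] unfolding mono_arr_iff[OF a(1)] by blast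
  next
    assume id: "\<beta> \<cdot> \<alpha> = Idn C A"
    have "g = \<beta> \<cdot> (\<alpha> \<cdot> g)" if "g \<in> hom C e A" for e g
      using assoc[OF that a(1,2)] id Idn_left[OF that] by simp
    then show "mono_arr C \<alpha>" unfolding mono_arr_iff[OF a(1)] by metis
  qed
qed

lemma terminal_point_iff_mono:
  "(A, \<alpha>, \<beta>) \<in> points C B \<Longrightarrow> terminal (Pt C B) (A, \<alpha>, \<beta>) \<longleftrightarrow> mono_arr C \<alpha>"
  using terminal_point_iff mono_retraction_iff by simp

end

context pointed_fc_cat
begin

text \<open>The zero object of \<open>Pt C B\<close> is \<open>B\<close> with identities; the unique
  map into it is \<alpha> and the unique map out of it is \<open>\<beta>'\<close>.\<close>

lemma zero_arr_Pt_iff: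
  assumes F: "((A, \<alpha>, \<beta>), f, (A', \<alpha>', \<beta>')) \<in> Arr (Pt C B)"
  shows "zero_arr (Pt C B) ((A, \<alpha>, \<beta>), f, (A', \<alpha>', \<beta>')) \<longleftrightarrow> f = \<beta>' \<cdot> \<alpha>"
proof -
  let ?S = "(A, \<alpha>, \<beta>)" and ?T = "(A', \<alpha>', \<beta>')" and ?z = "(B, Idn C B, Idn C B)"
  have S: "?S \<in> points C B" and T: "?T \<in> points C B" using F unfolding Pt_Arr_iff by auto
  have B: "B \<in> Obj C" using S hom_Obj unfolding points_iff by blast
  interpret P: pointed_cat "Pt C B" using pointed_cat_Pt[OF B] .
  have t: "(?S, \<alpha>, ?z) \<in> hom (Pt C B) ?S ?z"
    using S Idn_point[OF B] pt_map_retraction[OF S] unfolding Pt_hom_iff by blast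
  have "pt_map C \<beta>' ?z ?T" using T Idn_right unfolding pt_map_simp points_iff by auto
  then have i: "(?z, \<beta>', ?T) \<in> hom (Pt C B) ?z ?T"
    using T Idn_point[OF B] unfolding Pt_hom_iff by blast
  have z: "(?S, \<beta>' \<cdot> \<alpha>, ?T) \<in> hom (Pt C B) ?S ?T" "zero_arr (Pt C B) (?S, \<beta>' \<cdot> \<alpha>, ?T)"
    using P.comp_in[OF t i] P.zero_arrI[OF zero_object_Pt[OF B] t i] by (simp_all add: Pt_sel)
  have "(?S, f, ?T) \<in> hom (Pt C B) ?S ?T" using F by (simp add: hom_def Pt_sel)
  from P.zero_arr_unique[OF this z(1) _ z(2)] z(2) show ?thesis by auto
qed

text \<open>The kernel pair of \<open>f\<close> in the base lifts to a point over \<open>B\<close>,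
  with section the pair of \<beta> with itself. Its projections become maps of points, so a
  monomorphism of points already equalizes them.\<close>

lemma mono_Pt_iff:
  assumes F: "((A, \<alpha>, \<beta>), f, (A', \<alpha>', \<beta>')) \<in> Arr (Pt C B)"
  shows "mono_arr (Pt C B) ((A, \<alpha>, \<beta>), f, (A', \<alpha>', \<beta>')) \<longleftrightarrow> mono_arr C f"
proof -
  let ?S = "(A, \<alpha>, \<beta>)" and ?T = "(A', \<alpha>', \<beta>')"
  interpret P: cat "Pt C B" using category_Pt by unfold_locales
  have S: "?S \<in> points C B" and T: "?T \<in> points C B" using F unfolding Pt_Arr_iff by auto
  have a: "\<alpha> \<in> hom C A B" "\<beta> \<in> hom C B A" "\<alpha> \<cdot> \<beta> = Idn C B" "\<alpha>' \<in> hom C A' B"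
    and f: "f \<in> hom C A A'" "\<alpha>' \<cdot> f = \<alpha>" "f \<cdot> \<beta> = \<beta>'"
    using F unfolding Pt_Arr_iff pt_map_simp points_iff by auto
  have Fh: "(?S, f, ?T) \<in> hom (Pt C B) ?S ?T" using F by (simp add: hom_def Pt_sel)
  show ?thesis
  proof
    assume m: "mono_arr (Pt C B) (?S, f, ?T)"
    let ?K = "pb_obj C f f" and ?p = "proj1 C f f" and ?q = "proj2 C f f"
    note p = proj1_in[OF f(1) f(1)] and q = proj2_in[OF f(1) f(1)]
    define d where "d = pb_pair C f f \<beta> \<beta>"
    have d: "d \<in> hom C B ?K" "?p \<cdot> d = \<beta>" "?q \<cdot> d = \<beta>"
      using pb_pair_props[OF f(1) f(1) a(2) a(2) refl] unfolding d_def by auto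
    let ?R = "(?K, \<alpha> \<cdot> ?p, d)"
    have R: "?R \<in> points C B"
      using comp_in[OF p a(1)] d a assoc[OF d(1) p a(1)] by (intro pointsI) auto
    have "\<alpha> \<cdot> ?q = \<alpha> \<cdot> ?p"
      using assoc[OF p f(1) a(4)] assoc[OF q f(1) a(4)] f(2) proj_comm[OF f(1) f(1)] by simp
    then have "(?R, ?p, ?S) \<in> hom (Pt C B) ?R ?S" "(?R, ?q, ?S) \<in> hom (Pt C B) ?R ?S"
      using R S p q d unfolding Pt_hom_iff pt_map_simp by auto
    moreover have "(?S, f, ?T) \<cdot>\<^bsub>Pt C B\<^esub> (?R, ?p, ?S) = (?S, f, ?T) \<cdot>\<^bsub>Pt C B\<^esub> (?R, ?q, ?S)"
      using proj_comm[OF f(1) f(1)] by (simp add: Pt_sel)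
    ultimately have "(?R, ?p, ?S) = (?R, ?q, ?S)"
      using m unfolding P.mono_arr_iff[OF Fh] by blast
    then show "mono_arr C f" by (intro mono_if_proj_eq[OF f(1)]) simp
  next
    assume m: "mono_arr C f"
    show "mono_arr (Pt C B) (?S, f, ?T)" unfolding P.mono_arr_iff[OF Fh]
    proof (intro allI ballI impI)
      fix R G H assume GH: "G \<in> hom (Pt C B) R ?S" "H \<in> hom (Pt C B) R ?S"
        and eq: "(?S, f, ?T) \<cdot>\<^bsub>Pt C B\<^esub> G = (?S, f, ?T) \<cdot>\<^bsub>Pt C B\<^esub> H"
      obtain g h where g: "G = (R, g, ?S)" "g \<in> hom C (fst R) A"
        and h: "H = (R, h, ?S)" "h \<in> hom C (fst R) A"
        using GH unfolding Pt_hom_iff pt_map_def by auto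
      then show "G = H" using m eq unfolding mono_arr_iff[OF f(1)] by (auto simp: Pt_sel)
    qed
  qed
qed

section \<open>Kernels of morphisms of points\<close>

context
  fixes A \<alpha> \<beta> f A' \<alpha>' \<beta>' B
  assumes F: "((A, \<alpha>, \<beta>), f, (A', \<alpha>', \<beta>')) \<in> Arr (Pt C B)"
begin

text \<open>The pullback of \<open>f\<close> along \<open>\<beta>'\<close>, made a point over
  \<open>B\<close> by the retraction \<open>q\<close> and the section \<open>s\<close>;
  \<open>p\<close> will be the kernel of \<open>f\<close> in \<open>Pt C B\<close>.\<close>

private definition "p = proj1 C f \<beta>'"
private definition "q = proj2 C f \<beta>'"
private definition "s = pb_pair C f \<beta>' \<beta> (Idn C B)"

private lemma facts:
  "(A, \<alpha>, \<beta>) \<in> points C B" "(A', \<alpha>', \<beta>') \<in> points C B" "B \<in> Obj C"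
  "\<alpha> \<in> hom C A B" "\<beta> \<in> hom C B A" "\<alpha> \<cdot> \<beta> = Idn C B"
  "\<alpha>' \<in> hom C A' B" "\<beta>' \<in> hom C B A'" "\<alpha>' \<cdot> \<beta>' = Idn C B"
  "f \<in> hom C A A'" "\<alpha>' \<cdot> f = \<alpha>" "f \<cdot> \<beta> = \<beta>'"
  using F hom_Obj unfolding Pt_Arr_iff pt_map_simp points_iff by blast+

private lemma pq:
  "p \<in> hom C (pb_obj C f \<beta>') A" "q \<in> hom C (pb_obj C f \<beta>') B" "f \<cdot> p = \<beta>' \<cdot> q"
  unfolding p_def q_def
  using proj1_in[OF facts(10,8)] proj2_in[OF facts(10,8)] proj_comm[OF facts(10,8)] .

private lemma s: "s \<in> hom C B (pb_obj C f \<beta>')" "p \<cdot> s = \<beta>" "q \<cdot> s = Idn C B"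
proof -
  have "f \<cdot> \<beta> = \<beta>' \<cdot> Idn C B" using facts(8,12) Idn_right by simp
  from pb_pair_props[OF facts(10,8,5) Idn_in[OF facts(3)] this]
  show "s \<in> hom C B (pb_obj C f \<beta>')" "p \<cdot> s = \<beta>" "q \<cdot> s = Idn C B"
    unfolding s_def p_def q_def by auto
qed

private abbreviation "K \<equiv> (pb_obj C f \<beta>', q, s)"

private lemma K_point: "K \<in> points C B"
  using pq s by (intro pointsI)

private lemma p_hom: "(K, p, (A, \<alpha>, \<beta>)) \<in> hom (Pt C B) K (A, \<alpha>, \<beta>)"
proof -
  \<comment> \<open>\<open>\<alpha> \<cdot> p = \<alpha>' \<cdot> f \<cdot> p = \<alpha>' \<cdot>
    \<beta>' \<cdot> q = q\<close>.\<close>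
  have "\<alpha> \<cdot> p = q"
    using assoc[OF pq(1) facts(10,7)] assoc[OF pq(2) facts(8,7)] facts(9,11) pq Idn_left by simp
  then show ?thesis using K_point facts(1) pq s unfolding Pt_hom_iff pt_map_simp by auto
qed

private lemma F_hom:
  "((A, \<alpha>, \<beta>), f, (A', \<alpha>', \<beta>')) \<in> hom (Pt C B) (A, \<alpha>, \<beta>) (A', \<alpha>', \<beta>')"
  using F by (simp add: hom_def Pt_sel)

text \<open>A map of points \<open>g\<close> from a point with retraction \<gamma> is killed by
  \<open>f\<close> exactly when \<open>f \<cdot> g = \<beta>' \<cdot> \<gamma>\<close>, which says
  that \<open>g\<close> and \<gamma> form a pair into the pullback.\<close>

lemma Pt_kernel_exists: "\<exists>k. is_kernel (Pt C B) ((A, \<alpha>, \<beta>), f, (A', \<alpha>', \<beta>')) k"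
proof -
  interpret P: pointed_cat "Pt C B" using pointed_cat_Pt[OF facts(3)] .
  let ?S = "(A, \<alpha>, \<beta>)" and ?T = "(A', \<alpha>', \<beta>')"
  let ?F = "(?S, f, ?T)"
  have z: "?F \<cdot>\<^bsub>Pt C B\<^esub> ((G, \<gamma>, \<delta>), g, ?S) = P.zero (G, \<gamma>, \<delta>) ?T \<longleftrightarrow> f \<cdot> g = \<beta>' \<cdot> \<gamma>"
    if "((G, \<gamma>, \<delta>), g, ?S) \<in> hom (Pt C B) (G, \<gamma>, \<delta>) ?S" for G \<gamma> \<delta> g
    using P.comp_in[OF that F_hom] P.zero_arr_iff[OF P.comp_in[OF that F_hom]]
      zero_arr_Pt_iff[of G \<gamma> \<delta> "f \<cdot> g" A' \<alpha>' \<beta>' B] P.ArrI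
    by (simp add: Pt_sel)
  have "\<exists>!H. H \<in> hom (Pt C B) R K \<and> (K, p, ?S) \<cdot>\<^bsub>Pt C B\<^esub> H = G"
    if G: "G \<in> hom (Pt C B) R ?S" and FG: "?F \<cdot>\<^bsub>Pt C B\<^esub> G = P.zero R ?T" for R G
  proof -
    obtain D \<gamma> \<delta> where R: "R = (D, \<gamma>, \<delta>)" by (metis prod_cases3)
    obtain g where g: "G = (R, g, ?S)" "g \<in> hom C D A" "\<alpha> \<cdot> g = \<gamma>" "g \<cdot> \<delta> = \<beta>"
      and RP: "R \<in> points C B"
      using G unfolding R Pt_hom_iff pt_map_simp by blast
    have c: "\<gamma> \<in> hom C D B" "\<delta> \<in> hom C B D" "\<gamma> \<cdot> \<delta> = Idn C B"
      using RP unfolding R points_iff by auto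
    have fg: "f \<cdot> g = \<beta>' \<cdot> \<gamma>" using z G FG unfolding g(1) R by blast
    have "\<exists>!h. pt_map C h R K \<and> p \<cdot> h = g"
    proof (rule ex_ex1I)
      obtain h where h: "h \<in> hom C D (pb_obj C f \<beta>')" "p \<cdot> h = g" "q \<cdot> h = \<gamma>"
        using pb_univ[OF facts(10,8) g(2) c(1) fg] unfolding p_def q_def by blast
      \<comment> \<open>The pullback yields \<open>h\<close> only in the base; compatibility with
        sections is checked after both projections.\<close>
      have "h \<cdot> \<delta> = s"
        using pb_ext[OF facts(10,8) comp_in[OF c(2) h(1)] s(1)] s h g(4) c(3)
          assoc[OF c(2) h(1) pq(1)] assoc[OF c(2) h(1) pq(2)]
        unfolding p_def[symmetric] q_def[symmetric] by simp
      then show "\<exists>h. pt_map C h R K \<and> p \<cdot> h = g" using h unfolding R pt_map_simp by blast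
    next
      fix h h' assume "pt_map C h R K \<and> p \<cdot> h = g" "pt_map C h' R K \<and> p \<cdot> h' = g"
      then show "h = h'" using pb_ext[OF facts(10,8), of h D h']
        unfolding R pt_map_simp p_def[symmetric] q_def[symmetric] by simp
    qed
    then obtain h where h: "pt_map C h R K" "p \<cdot> h = g"
      and uniq: "\<And>h'. pt_map C h' R K \<Longrightarrow> p \<cdot> h' = g \<Longrightarrow> h' = h"
      by (elim ex1E) blast
    show ?thesis
    proof (rule ex1I[of _ "(R, h, K)"])
      show "(R, h, K) \<in> hom (Pt C B) R K \<and> (K, p, ?S) \<cdot>\<^bsub>Pt C B\<^esub> (R, h, K) = G"
        using RP K_point h unfolding Pt_hom_iff g(1) by (simp add: Pt_sel)
    next
      fix H assume "H \<in> hom (Pt C B) R K \<and> (K, p, ?S) \<cdot>\<^bsub>Pt C B\<^esub> H = G"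
      then obtain h' where "H = (R, h', K)" "pt_map C h' R K" "p \<cdot> h' = g"
        unfolding Pt_hom_iff g(1) by (auto simp: Pt_sel)
      with uniq show "H = (R, h, K)" by blast
    qed
  qed
  moreover have "?F \<cdot>\<^bsub>Pt C B\<^esub> (K, p, ?S) = P.zero K ?T" using z[OF p_hom] pq(3) by blast
  ultimately show ?thesis unfolding P.is_kernel_iff[OF F_hom] using p_hom by blast
qed

text \<open>Triviality in the category of points forces \<open>p = \<beta> \<cdot> q\<close>. If
  \<open>f \<cdot> g = 0\<close> in the base, then \<open>g\<close> and 0 form a pair into the
  pullback, so \<open>g = \<beta> \<cdot> 0\<close>.\<close>

lemma trivial_kernel_Pt_imp:
  assumes tr: "pointed_cat.trivial_kernel (Pt C B) ((A, \<alpha>, \<beta>), f, (A', \<alpha>', \<beta>'))"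
  shows "trivial_kernel f"
proof -
  interpret P: pointed_cat "Pt C B" using pointed_cat_Pt[OF facts(3)] .
  let ?S = "(A, \<alpha>, \<beta>)" and ?T = "(A', \<alpha>', \<beta>')"
  let ?F = "(?S, f, ?T)"
  note c = P.comp_in[OF p_hom F_hom]
  have "zero_arr (Pt C B) (?F \<cdot>\<^bsub>Pt C B\<^esub> (K, p, ?S))"
    using zero_arr_Pt_iff P.ArrI[OF c] pq(3) by (simp add: Pt_sel)
  then have "(K, p, ?S) = P.zero K ?S"
    using tr p_hom P.zero_arr_iff[OF c] unfolding P.trivial_kernel_iff[OF F_hom] by blast
  then have "zero_arr (Pt C B) (K, p, ?S)" using P.zero_arr_iff[OF p_hom] by simp
  then have p: "p = \<beta> \<cdot> q" using zero_arr_Pt_iff P.ArrI[OF p_hom] by blast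
  show ?thesis unfolding trivial_kernel_iff[OF facts(10)]
  proof (intro allI ballI impI)
    fix e g assume g: "g \<in> hom C e A" "f \<cdot> g = zero e A'"
    have e: "e \<in> Obj C" using hom_Obj[OF g(1)] by blast
    note z = zero_in[OF e facts(3)]
    have "f \<cdot> g = \<beta>' \<cdot> zero e B" using g(2) comp_zero[OF facts(8) e] by simp
    then obtain h where h: "h \<in> hom C e (pb_obj C f \<beta>')" "p \<cdot> h = g" "q \<cdot> h = zero e B"
      using pb_univ[OF facts(10,8) g(1) z] unfolding p_def q_def by blast
    then have "g = \<beta> \<cdot> (q \<cdot> h)" using p assoc[OF h(1) pq(2) facts(5)] by simp
    then show "g = zero e A" using h(3) comp_zero[OF facts(5) e] by simp
  qed
qed

text \<open>Over a zero object the sections are zero, so the zero morphisms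
  \<open>\<beta>' \<cdot> \<gamma>\<close> of points are zero in the base. This is what brings (d)
  back to (a).\<close>

lemma trivial_kernel_Pt_zero:
  assumes B: "zero_object C B" and tr: "trivial_kernel f"
  shows "pointed_cat.trivial_kernel (Pt C B) ((A, \<alpha>, \<beta>), f, (A', \<alpha>', \<beta>'))"
proof -
  interpret P: pointed_cat "Pt C B" using pointed_cat_Pt[OF facts(3)] .
  let ?S = "(A, \<alpha>, \<beta>)" and ?T = "(A', \<alpha>', \<beta>')"
  let ?F = "(?S, f, ?T)"
  have i: "initial C B" using B unfolding zero_object_def by blast
  have o: "A \<in> Obj C" "A' \<in> Obj C" using hom_Obj[OF facts(10)] by auto
  have "G = P.zero R ?S" if G: "G \<in> hom (Pt C B) R ?S" and FG: "?F \<cdot>\<^bsub>Pt C B\<^esub> G = P.zero R ?T" for R G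
  proof -
    obtain D \<gamma> \<delta> where R: "R = (D, \<gamma>, \<delta>)" by (metis prod_cases3)
    obtain g where g: "G = (R, g, ?S)" "g \<in> hom C D A" and RP: "R \<in> points C B"
      using G unfolding R Pt_hom_iff pt_map_simp by blast
    have c: "\<gamma> \<in> hom C D B" using RP unfolding R points_iff by auto
    note FGh = P.comp_in[OF G F_hom]
    have "f \<cdot> g = \<beta>' \<cdot> \<gamma>"
      using zero_arr_Pt_iff[of D \<gamma> \<delta> "f \<cdot> g" A' \<alpha>' \<beta>' B] P.ArrI[OF FGh]
        P.zero_arr_iff[OF FGh] FG
      unfolding g(1) R by (simp add: Pt_sel)
    then have "f \<cdot> g = zero D A'"
      using from_zero_object[OF i facts(8)] zero_comp[OF c o(2)] by simp
    then have "g = zero D A" using tr g(2) unfolding trivial_kernel_iff[OF facts(10)] by blast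
    then have "g = \<beta> \<cdot> \<gamma>" using from_zero_object[OF i facts(5)] zero_comp[OF c o(1)] by simp
    then show ?thesis
      using zero_arr_Pt_iff P.ArrI[OF G] P.zero_arr_iff[OF G] unfolding g(1) R by blast
  qed
  then show ?thesis unfolding P.trivial_kernel_iff[OF F_hom] by blast
qed

end

lemma kernel_is_zero_Pt_iff:
  assumes "B \<in> Obj C" "F \<in> Arr (Pt C B)"
  shows "kernel_is_zero (Pt C B) F \<longleftrightarrow> pointed_cat.trivial_kernel (Pt C B) F"
proof -
  interpret P: pointed_cat "Pt C B" using pointed_cat_Pt[OF assms(1)] .
  obtain A \<alpha> \<beta> f A' \<alpha>' \<beta>' where "F = ((A, \<alpha>, \<beta>), f, (A', \<alpha>', \<beta>'))" by (metis prod_cases3)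
  with Pt_kernel_exists assms(2) obtain k where "is_kernel (Pt C B) F k" by blast
  then show ?thesis using P.kernel_is_zero_iff[OF P.Arr_in_hom[OF assms(2)]] by blast
qed

section \<open>Kernel and pullback functors\<close>

text \<open>From \<open>\<alpha>' \<cdot> f = \<alpha>\<close> the composite
  \<open>f \<cdot> kernel C \<alpha>\<close> is killed by \<open>\<alpha>'\<close>, so the
  \<open>THE\<close> in \<open>Ker\<close> denotes its unique factorization.\<close>

lemma Ker_AMap:
  assumes F: "((A, \<alpha>, \<beta>), f, (A', \<alpha>', \<beta>')) \<in> Arr (Pt C B)"
  defines "h \<equiv> AMap (Ker C B) ((A, \<alpha>, \<beta>), f, (A', \<alpha>', \<beta>'))"
  shows "h \<in> hom C (Dom C (kernel C \<alpha>)) (Dom C (kernel C \<alpha>'))"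
    and "kernel C \<alpha>' \<cdot> h = f \<cdot> kernel C \<alpha>"
proof -
  have a: "\<alpha> \<in> hom C A B" "\<alpha>' \<in> hom C A' B" and f: "f \<in> hom C A A'" "\<alpha>' \<cdot> f = \<alpha>"
    using F unfolding Pt_Arr_iff pt_map_simp points_iff by auto
  note k = kernel_props[OF a(1)]
  have "\<alpha>' \<cdot> (f \<cdot> kernel C \<alpha>) = zero (Dom C (kernel C \<alpha>)) B"
    using assoc[OF k(1) f(1) a(2)] f(2) k(2) by simp
  from theI'[OF kernel_props(3)[OF a(2) comp_in[OF k(1) f(1)] this]]
  show "h \<in> hom C (Dom C (kernel C \<alpha>)) (Dom C (kernel C \<alpha>'))"
    and "kernel C \<alpha>' \<cdot> h = f \<cdot> kernel C \<alpha>"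
    unfolding h_def Ker_def by auto
qed

text \<open>Whatever \<open>f\<close> kills is also killed by
  \<open>\<alpha> = \<alpha>' \<cdot> f\<close>, hence factors through the kernel of \<alpha>, where
  the induced map \<open>h\<close> kills the factor.\<close>

lemma mono_Ker_trivial_kernel:
  assumes F: "((A, \<alpha>, \<beta>), f, (A', \<alpha>', \<beta>')) \<in> Arr (Pt C B)"
    and m: "mono_arr C (AMap (Ker C B) ((A, \<alpha>, \<beta>), f, (A', \<alpha>', \<beta>')))"
  shows "trivial_kernel f"
proof -
  define h where "h = AMap (Ker C B) ((A, \<alpha>, \<beta>), f, (A', \<alpha>', \<beta>'))"
  note h = Ker_AMap[OF F, folded h_def]
  have a: "\<alpha> \<in> hom C A B" "\<alpha>' \<in> hom C A' B" and f: "f \<in> hom C A A'" "\<alpha>' \<cdot> f = \<alpha>"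
    using F unfolding Pt_Arr_iff pt_map_simp points_iff by auto
  note k = kernel_props[OF a(1)] and k' = kernel_props[OF a(2)]
  show ?thesis unfolding trivial_kernel_iff[OF f(1)]
  proof (intro allI ballI impI)
    fix e g assume g: "g \<in> hom C e A" "f \<cdot> g = zero e A'"
    have e: "e \<in> Obj C" using hom_Obj[OF g(1)] by blast
    have "\<alpha> \<cdot> g = zero e B" using assoc[OF g(1) f(1) a(2)] f(2) g(2) comp_zero[OF a(2) e] by simp
    then obtain g' where g': "g' \<in> hom C e (Dom C (kernel C \<alpha>))" "kernel C \<alpha> \<cdot> g' = g"
      using k(3) g(1) by blast
    let ?z = "zero e (Dom C (kernel C \<alpha>))"
    have K: "Dom C (kernel C \<alpha>) \<in> Obj C" using hom_Obj[OF k(1)] by blast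
    note z = zero_in[OF e K]
    have "kernel C \<alpha>' \<cdot> (h \<cdot> g') = f \<cdot> g"
      using assoc[OF g'(1) h(1) k'(1)] assoc[OF g'(1) k(1) f(1)] h(2) g'(2) by simp
    also have "\<dots> = kernel C \<alpha>' \<cdot> (h \<cdot> ?z)"
      using g(2) comp_zero[OF h(1) e] comp_zero[OF k'(1) e] by simp
    finally have "h \<cdot> g' = h \<cdot> ?z"
      by (rule kernel_mono[OF a(2) comp_in[OF g'(1) h(1)] comp_in[OF z h(1)]])
    then have "g' = ?z" using m g'(1) z unfolding h_def[symmetric] mono_arr_iff[OF h(1)] by blast
    then show "g = zero e A" using g'(2) comp_zero[OF k(1) e] by simp
  qed
qed

section \<open>Pullback functors between categories of points\<close>

context
  fixes u E B A \<alpha> \<beta>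
  assumes u: "u \<in> hom C E B" and S: "(A, \<alpha>, \<beta>) \<in> points C B"
begin

private lemma point_facts:
  "\<alpha> \<in> hom C A B" "\<beta> \<in> hom C B A" "\<alpha> \<cdot> \<beta> = Idn C B" "E \<in> Obj C" "B \<in> Obj C"
  using S u hom_Obj unfolding points_iff by blast+

lemma pb_point_props:
  shows pb_point_in: "pb_point C u (A, \<alpha>, \<beta>) \<in> points C E"
    and proj2_section: "proj2 C u \<alpha> \<cdot> snd (snd (pb_point C u (A, \<alpha>, \<beta>))) = \<beta> \<cdot> u"
proof -
  have "u \<cdot> Idn C E = \<alpha> \<cdot> (\<beta> \<cdot> u)"
    using assoc[OF u point_facts(2,1)] point_facts(3) Idn_left[OF u] Idn_right[OF u] by simp
  from pb_pair_props[OF u point_facts(1) Idn_in[OF point_facts(4)] comp_in[OF u point_facts(2)] this]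
  show "pb_point C u (A, \<alpha>, \<beta>) \<in> points C E"
    and "proj2 C u \<alpha> \<cdot> snd (snd (pb_point C u (A, \<alpha>, \<beta>))) = \<beta> \<cdot> u"
    using pointsI[OF proj1_in[OF u point_facts(1)]] Dom_hom[OF u] unfolding pb_point_def by auto
qed

lemma terminal_pb_point_iff:
  "terminal (Pt C E) (pb_point C u (A, \<alpha>, \<beta>)) \<longleftrightarrow> mono_arr C (proj1 C u \<alpha>)"
  using pb_point_in terminal_point_iff_mono unfolding pb_point_def by simp

text \<open>Pulling back along a morphism from zero yields the kernel object of \<alpha>. Both
  projections are then determined, so any two parallel morphisms into the pullback agree and its
  first projection is mono.\<close>

lemma trivial_kernel_imp_terminal_pb:
  assumes E: "zero_object C E" and tr: "trivial_kernel \<alpha>"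
  shows "terminal (Pt C E) (pb_point C u (A, \<alpha>, \<beta>))"
proof -
  let ?P = "pb_obj C u \<alpha>"
  note p = proj1_in[OF u point_facts(1)] and q = proj2_in[OF u point_facts(1)]
  have i: "initial C E" and t: "terminal C E" using E unfolding zero_object_def by auto
  have o: "?P \<in> Obj C" using hom_Obj[OF p] by blast
  have "\<alpha> \<cdot> proj2 C u \<alpha> = zero ?P B"
    using proj_comm[OF u point_facts(1)] from_zero_object[OF i u] zero_comp[OF p point_facts(5)] by simp
  then have q0: "proj2 C u \<alpha> = zero ?P A" using tr q unfolding trivial_kernel_iff[OF point_facts(1)] by blast
  have A: "A \<in> Obj C" using hom_Obj[OF q] by blast
  have "g = h" if g: "g \<in> hom C e ?P" and h: "h \<in> hom C e ?P" for e g h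
  proof (rule pb_ext[OF u point_facts(1) g h])
    show "proj1 C u \<alpha> \<cdot> g = proj1 C u \<alpha> \<cdot> h"
      using terminal_unique[OF t comp_in[OF g p] comp_in[OF h p]] .
    show "proj2 C u \<alpha> \<cdot> g = proj2 C u \<alpha> \<cdot> h"
      using zero_comp[OF g A] zero_comp[OF h A] q0 by simp
  qed
  then show ?thesis unfolding terminal_pb_point_iff mono_arr_iff[OF p] by blast
qed

end

context
  fixes u E B A \<alpha> \<beta> f A' \<alpha>' \<beta>'
  assumes u: "u \<in> hom C E B" and F: "((A, \<alpha>, \<beta>), f, (A', \<alpha>', \<beta>')) \<in> Arr (Pt C B)"
begin

private lemma map_facts:
  "\<alpha> \<in> hom C A B" "\<beta> \<in> hom C B A" "\<alpha>' \<in> hom C A' B" "f \<in> hom C A A'"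
  "\<alpha>' \<cdot> f = \<alpha>" "f \<cdot> \<beta> = \<beta>'" "(A, \<alpha>, \<beta>) \<in> points C B" "(A', \<alpha>', \<beta>') \<in> points C B" "E \<in> Obj C"
  using F hom_Obj u unfolding Pt_Arr_iff pt_map_simp points_iff by blast+

private definition "w = pb_pair C u \<alpha>' (proj1 C u \<alpha>) (f \<cdot> proj2 C u \<alpha>)"

private lemma w:
  "w \<in> hom C (pb_obj C u \<alpha>) (pb_obj C u \<alpha>')"
  "proj1 C u \<alpha>' \<cdot> w = proj1 C u \<alpha>" "proj2 C u \<alpha>' \<cdot> w = f \<cdot> proj2 C u \<alpha>"
proof -
  note p = proj1_in[OF u map_facts(1)] and q = proj2_in[OF u map_facts(1)]
  have "u \<cdot> proj1 C u \<alpha> = \<alpha>' \<cdot> (f \<cdot> proj2 C u \<alpha>)"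
    using proj_comm[OF u map_facts(1)] assoc[OF q map_facts(4,3)] map_facts(5) by simp
  from pb_pair_props[OF u map_facts(3) p comp_in[OF q map_facts(4)] this]
  show "w \<in> hom C (pb_obj C u \<alpha>) (pb_obj C u \<alpha>')"
    "proj1 C u \<alpha>' \<cdot> w = proj1 C u \<alpha>" "proj2 C u \<alpha>' \<cdot> w = f \<cdot> proj2 C u \<alpha>"
    unfolding w_def by auto
qed

private lemma AMap_eq: "AMap (pb_functor C u) ((A, \<alpha>, \<beta>), f, (A', \<alpha>', \<beta>')) =
    (pb_point C u (A, \<alpha>, \<beta>), w, pb_point C u (A', \<alpha>', \<beta>'))"
  by (simp add: pb_functor_def w_def)

lemma pb_functor_AMap_in:
  "AMap (pb_functor C u) ((A, \<alpha>, \<beta>), f, (A', \<alpha>', \<beta>')) \<in>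
    hom (Pt C E) (pb_point C u (A, \<alpha>, \<beta>)) (pb_point C u (A', \<alpha>', \<beta>'))"
proof -
  note pt = pb_point_in[OF u map_facts(7)] and pt' = pb_point_in[OF u map_facts(8)]
  obtain s where s: "pb_point C u (A, \<alpha>, \<beta>) = (pb_obj C u \<alpha>, proj1 C u \<alpha>, s)"
    "proj2 C u \<alpha> \<cdot> s = \<beta> \<cdot> u"
    using proj2_section[OF u map_facts(7)] unfolding pb_point_def by auto
  obtain s' where s': "pb_point C u (A', \<alpha>', \<beta>') = (pb_obj C u \<alpha>', proj1 C u \<alpha>', s')"
    "proj2 C u \<alpha>' \<cdot> s' = \<beta>' \<cdot> u"
    using proj2_section[OF u map_facts(8)] unfolding pb_point_def by auto
  have ss: "s \<in> hom C E (pb_obj C u \<alpha>)" "proj1 C u \<alpha> \<cdot> s = Idn C E"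
    "s' \<in> hom C E (pb_obj C u \<alpha>')" "proj1 C u \<alpha>' \<cdot> s' = Idn C E"
    using pt pt' unfolding s(1) s'(1) points_iff by auto
  note q = proj2_in[OF u map_facts(1)] and p' = proj1_in[OF u map_facts(3)]
    and q' = proj2_in[OF u map_facts(3)]
  \<comment> \<open>Both sides project to the identity of \<open>E\<close> and to
    \<open>\<beta>' \<cdot> u\<close>, the latter because
    \<open>f \<cdot> \<beta> = \<beta>'\<close>.\<close>
  have "w \<cdot> s = s'"
  proof (rule pb_ext[OF u map_facts(3) comp_in[OF ss(1) w(1)] ss(3)])
    show "proj1 C u \<alpha>' \<cdot> (w \<cdot> s) = proj1 C u \<alpha>' \<cdot> s'"
      using assoc[OF ss(1) w(1) p'] w(2) ss by simp
    show "proj2 C u \<alpha>' \<cdot> (w \<cdot> s) = proj2 C u \<alpha>' \<cdot> s'"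
      using assoc[OF ss(1) w(1) q'] w(3) assoc[OF ss(1) q map_facts(4)] s(2) s'(2)
        assoc[OF u map_facts(2,4)] map_facts(6) by simp
  qed
  then show ?thesis
    using pt pt' w(1,2) unfolding AMap_eq s(1) s'(1) Pt_hom_iff pt_map_simp by auto
qed

text \<open>If \<open>f \<cdot> g = 0\<close> then also \<open>\<alpha> \<cdot> g = 0\<close>, so 0
  and \<open>g\<close> form a pair into the pullback of \<alpha>. The morphism \<open>w\<close>
  underlying the image of \<open>f\<close> kills this pair and is mono in the base.\<close>

lemma mono_pb_trivial_kernel:
  assumes "mono_arr (Pt C E) (AMap (pb_functor C u) ((A, \<alpha>, \<beta>), f, (A', \<alpha>', \<beta>')))"
  shows "trivial_kernel f"
proof -
  have "AMap (pb_functor C u) ((A, \<alpha>, \<beta>), f, (A', \<alpha>', \<beta>')) \<in> Arr (Pt C E)"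
    using pb_functor_AMap_in unfolding hom_def by blast
  then have m: "mono_arr C w"
    using assms mono_Pt_iff unfolding AMap_eq pb_point_def by simp
  show ?thesis unfolding trivial_kernel_iff[OF map_facts(4)]
  proof (intro allI ballI impI)
    fix e g assume g: "g \<in> hom C e A" "f \<cdot> g = zero e A'"
    have e: "e \<in> Obj C" using hom_Obj[OF g(1)] by blast
    note p = proj1_in[OF u map_facts(1)] and q = proj2_in[OF u map_facts(1)]
      and p' = proj1_in[OF u map_facts(3)] and q' = proj2_in[OF u map_facts(3)]
    have "\<alpha> \<cdot> g = zero e B"
      using assoc[OF g(1) map_facts(4,3)] map_facts(5) g(2) comp_zero[OF map_facts(3) e] by simp
    then have "u \<cdot> zero e E = \<alpha> \<cdot> g" using comp_zero[OF u e] by simp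
    then obtain h where h: "h \<in> hom C e (pb_obj C u \<alpha>)" "proj1 C u \<alpha> \<cdot> h = zero e E"
      "proj2 C u \<alpha> \<cdot> h = g"
      using pb_univ[OF u map_facts(1) zero_in[OF e map_facts(9)] g(1)] by blast
    have P: "pb_obj C u \<alpha> \<in> Obj C" using hom_Obj[OF p] by blast
    have P': "pb_obj C u \<alpha>' \<in> Obj C" using hom_Obj[OF p'] by blast
    note z = zero_in[OF e P]
    have "w \<cdot> h = zero e (pb_obj C u \<alpha>')"
    proof (rule pb_ext[OF u map_facts(3) comp_in[OF h(1) w(1)] zero_in[OF e P']])
      show "proj1 C u \<alpha>' \<cdot> (w \<cdot> h) = proj1 C u \<alpha>' \<cdot> zero e (pb_obj C u \<alpha>')"
        using assoc[OF h(1) w(1) p'] w(2) h(2) comp_zero[OF p' e] by simp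
      show "proj2 C u \<alpha>' \<cdot> (w \<cdot> h) = proj2 C u \<alpha>' \<cdot> zero e (pb_obj C u \<alpha>')"
        using assoc[OF h(1) w(1) q'] w(3) assoc[OF h(1) q map_facts(4)] h(3) g(2)
          comp_zero[OF q' e] by simp
    qed
    then have "h = zero e (pb_obj C u \<alpha>)"
      using m h(1) z comp_zero[OF w(1) e] unfolding mono_arr_iff[OF w(1)] by simp
    then show "g = zero e A" using h(3) comp_zero[OF q e] by simp
  qed
qed

end

end

theorem proposition3p7:
  fixes X :: "('o, 'm) cat"
  assumes "category X" and "pointed X" and "finitely_complete X"
  shows
    "let
       a = (\<forall>f\<in>Arr X. mono_arr X f \<longleftrightarrow> kernel_is_zero X f);
       b = (\<forall>B\<in>Obj X. reflects_terminal_objects (Ker X B));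
       c = (\<forall>B\<in>Obj X. reflects_monomorphisms (Ker X B));
       d = (\<forall>B\<in>Obj X. \<forall>f\<in>Arr (Pt X B). mono_arr (Pt X B) f \<longleftrightarrow> kernel_is_zero (Pt X B) f);
       e = (\<forall>p\<in>Arr X. reflects_terminal_objects (pb_functor X p));
       f = (\<forall>p\<in>Arr X. reflects_monomorphisms (pb_functor X p))
     in (a \<longleftrightarrow> b) \<and> (b \<longleftrightarrow> c) \<and> (c \<longleftrightarrow> d) \<and> (d \<longleftrightarrow> e) \<and> (e \<longleftrightarrow> f)"
proof -
  interpret X: pointed_fc_cat X using assms by unfold_locales
  let ?a = "\<forall>f\<in>Arr X. mono_arr X f \<longleftrightarrow> kernel_is_zero X f"
  let ?b = "\<forall>B\<in>Obj X. reflects_terminal_objects (Ker X B)"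
  let ?c = "\<forall>B\<in>Obj X. reflects_monomorphisms (Ker X B)"
  let ?d = "\<forall>B\<in>Obj X. \<forall>f\<in>Arr (Pt X B). mono_arr (Pt X B) f \<longleftrightarrow> kernel_is_zero (Pt X B) f"
  let ?e = "\<forall>p\<in>Arr X. reflects_terminal_objects (pb_functor X p)"
  let ?f = "\<forall>p\<in>Arr X. reflects_monomorphisms (pb_functor X p)"
  \<comment> \<open>Monomorphisms have trivial kernel in every pointed category, so only the
    converse carries content.\<close>
  have a_iff: "?a \<longleftrightarrow> (\<forall>f\<in>Arr X. X.trivial_kernel f \<longrightarrow> mono_arr X f)"
    using X.kernel_is_zero_trivial X.mono_trivial_kernel by blast
  \<comment> \<open>The implication of \<open>a_iff\<close> restricted to retractions of points: the
    premise is terminality of the kernel object, the conclusion terminality of the point.\<close>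
  have b_iff: "?b \<longleftrightarrow> (\<forall>B A \<alpha> \<beta>. (A, \<alpha>, \<beta>) \<in> points X B \<longrightarrow> X.trivial_kernel \<alpha> \<longrightarrow> mono_arr X \<alpha>)"
  proof -
    have "terminal X (OMap (Ker X B) (A, \<alpha>, \<beta>)) \<longleftrightarrow> X.trivial_kernel \<alpha>"
      and "terminal (Pt X B) (A, \<alpha>, \<beta>) \<longleftrightarrow> mono_arr X \<alpha>" and "B \<in> Obj X"
      if "(A, \<alpha>, \<beta>) \<in> points X B" for A \<alpha> \<beta> B
      using that X.terminal_kernel_iff[of \<alpha> A B] X.terminal_point_iff_mono[OF that] X.hom_Obj
      unfolding points_iff by (auto simp: Ker_def)
    then show ?thesis
      unfolding reflects_terminal_objects_def by (fastforce simp: Ker_def Pt_sel)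
  qed
  have ab: "?a \<longleftrightarrow> ?b"
    unfolding a_iff b_iff
  proof
    assume "\<forall>f\<in>Arr X. X.trivial_kernel f \<longrightarrow> mono_arr X f"
    then show "\<forall>B A \<alpha> \<beta>. (A, \<alpha>, \<beta>) \<in> points X B \<longrightarrow> X.trivial_kernel \<alpha> \<longrightarrow> mono_arr X \<alpha>"
      using X.ArrI unfolding points_iff by blast
  next
    assume "\<forall>B A \<alpha> \<beta>. (A, \<alpha>, \<beta>) \<in> points X B \<longrightarrow> X.trivial_kernel \<alpha> \<longrightarrow> mono_arr X \<alpha>"
    then show "\<forall>f\<in>Arr X. X.trivial_kernel f \<longrightarrow> mono_arr X f"
      using X.trivial_kernel_mono[OF X.Arr_in_hom] X.pointsI by blast
  qed
  have ac: ?c if ?a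
  proof -
    have "mono_arr (Pt X B) F" if F: "F \<in> Arr (Pt X B)" "mono_arr X (AMap (Ker X B) F)" for B F
    proof -
      obtain A \<alpha> \<beta> f A' \<alpha>' \<beta>' where eq: "F = ((A, \<alpha>, \<beta>), f, (A', \<alpha>', \<beta>'))" by (metis prod_cases3)
      have "X.trivial_kernel f" using X.mono_Ker_trivial_kernel F unfolding eq by blast
      moreover have "f \<in> Arr X" using F(1) X.ArrI unfolding eq Pt_Arr_iff pt_map_simp by blast
      ultimately show ?thesis using \<open>?a\<close> X.mono_Pt_iff F(1) unfolding a_iff eq by blast
    qed
    then show ?thesis unfolding reflects_monomorphisms_def by (simp add: Ker_def)
  qed
  have cb: ?b if c: ?c
    unfolding b_iff
  proof (intro allI impI)
    fix B A \<alpha> \<beta> assume S: "(A, \<alpha>, \<beta>) \<in> points X B" and tr: "X.trivial_kernel \<alpha>"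
    have a: "\<alpha> \<in> hom X A B" and B: "B \<in> Obj X"
      using S X.hom_Obj unfolding points_iff by blast+
    let ?F = "((A, \<alpha>, \<beta>), \<alpha>, (B, Idn X B, Idn X B))"
    have F: "?F \<in> Arr (Pt X B)"
      using S X.Idn_point[OF B] X.pt_map_retraction[OF S] unfolding Pt_Arr_iff by blast
    \<comment> \<open>By \<open>tr\<close> the domain of this morphism, the kernel object of
      \<alpha>, is terminal, and every morphism out of a terminal object is mono.\<close>
    have "mono_arr X (AMap (Ker X B) ?F)"
      using X.mono_from_terminal[OF X.Ker_AMap(1)[OF F]] X.terminal_kernel_iff[OF a] tr by blast
    moreover have "Src (Ker X B) = Pt X B" "Tgt (Ker X B) = X" by (simp_all add: Ker_def)
    ultimately have "mono_arr (Pt X B) ?F"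
      using c B F unfolding reflects_monomorphisms_def by metis
    then show "mono_arr X \<alpha>" using X.mono_Pt_iff[OF F] by blast
  qed
  have ad: ?d if ?a
  proof (intro ballI)
    fix B F assume B: "B \<in> Obj X" and F: "F \<in> Arr (Pt X B)"
    interpret P: pointed_cat "Pt X B" using X.pointed_cat_Pt[OF B] .
    obtain A \<alpha> \<beta> f A' \<alpha>' \<beta>' where eq: "F = ((A, \<alpha>, \<beta>), f, (A', \<alpha>', \<beta>'))" by (metis prod_cases3)
    have f: "f \<in> Arr X" using F X.ArrI unfolding eq Pt_Arr_iff pt_map_simp by blast
    have "mono_arr (Pt X B) F" if "P.trivial_kernel F"
      using X.trivial_kernel_Pt_imp X.mono_Pt_iff F that f \<open>?a\<close> unfolding a_iff eq by blast
    then show "mono_arr (Pt X B) F \<longleftrightarrow> kernel_is_zero (Pt X B) F"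
      using X.kernel_is_zero_Pt_iff[OF B F] P.mono_trivial_kernel[OF F] by blast
  qed
  obtain z where z: "zero_object X z" "initial X z" "terminal X z" "z \<in> Obj X"
    using X.zero_objectE .
  have da: ?a if ?d
    unfolding a_iff
  proof (intro ballI impI)
    fix f assume f: "f \<in> Arr X" and tr: "X.trivial_kernel f"
    have fh: "f \<in> hom X (Dom X f) (Cod X f)" using X.Arr_in_hom[OF f] .
    \<comment> \<open>Over the zero object each object carries a point structure given by zero
      morphisms, and every morphism of \<open>X\<close> respects it.\<close>
    have S: "(a, X.zero a z, X.zero z a) \<in> points X z" if "a \<in> Obj X" for a
      using X.zero_in[OF that z(4)] X.zero_in[OF z(4) that] X.Idn_in[OF z(4)]
      by (intro X.pointsI X.terminal_unique[OF z(3), of _ z] X.comp_in)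
    have o: "Dom X f \<in> Obj X" "Cod X f \<in> Obj X" using X.hom_Obj[OF fh] by auto
    let ?F = "((Dom X f, X.zero (Dom X f) z, X.zero z (Dom X f)), f,
      (Cod X f, X.zero (Cod X f) z, X.zero z (Cod X f)))"
    have F: "?F \<in> Arr (Pt X z)"
      using S o fh X.zero_comp[OF fh z(4)] X.comp_zero[OF fh z(4)]
      unfolding Pt_Arr_iff pt_map_simp by simp
    have "mono_arr (Pt X z) ?F"
      using X.trivial_kernel_Pt_zero[OF F z(1) tr] X.kernel_is_zero_Pt_iff[OF z(4) F] F \<open>?d\<close> z(4)
      by blast
    then show "mono_arr X f" using X.mono_Pt_iff[OF F] by blast
  qed
  have af: ?f if ?a
  proof
    fix p assume p: "p \<in> Arr X"
    have "mono_arr (Pt X (Cod X p)) F"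
      if F: "F \<in> Arr (Pt X (Cod X p))" "mono_arr (Pt X (Dom X p)) (AMap (pb_functor X p) F)" for F
    proof -
      obtain A \<alpha> \<beta> f A' \<alpha>' \<beta>' where eq: "F = ((A, \<alpha>, \<beta>), f, (A', \<alpha>', \<beta>'))" by (metis prod_cases3)
      have "X.trivial_kernel f"
        using X.mono_pb_trivial_kernel[OF X.Arr_in_hom[OF p]] F unfolding eq by blast
      moreover have "f \<in> Arr X" using F(1) X.ArrI unfolding eq Pt_Arr_iff pt_map_simp by blast
      ultimately show ?thesis using \<open>?a\<close> X.mono_Pt_iff F(1) unfolding a_iff eq by blast
    qed
    then show "reflects_monomorphisms (pb_functor X p)"
      unfolding reflects_monomorphisms_def by (simp add: pb_functor_def)
  qed
  have fe: ?e if f: ?f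
  proof
    fix p assume p: "p \<in> Arr X"
    let ?B = "Cod X p" and ?E = "Dom X p"
    note ph = X.Arr_in_hom[OF p]
    have sel: "Src (pb_functor X p) = Pt X ?B" "Tgt (pb_functor X p) = Pt X ?E"
      "OMap (pb_functor X p) = pb_point X p"
      by (simp_all add: pb_functor_def)
    have B: "?B \<in> Obj X" using X.hom_Obj[OF ph] by blast
    interpret P: cat "Pt X ?E" using X.category_Pt by unfold_locales
    have "terminal (Pt X ?B) S"
      if S: "S \<in> points X ?B" and t: "terminal (Pt X ?E) (pb_point X p S)" for S
    proof -
      obtain A \<alpha> \<beta> where eq: "S = (A, \<alpha>, \<beta>)" by (metis prod_cases3)
      let ?F = "((A, \<alpha>, \<beta>), \<alpha>, (?B, Idn X ?B, Idn X ?B))"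
      have F: "?F \<in> Arr (Pt X ?B)"
        using S X.Idn_point[OF B] X.pt_map_retraction unfolding eq Pt_Arr_iff by blast
      \<comment> \<open>Its domain is the pulled back point, which is terminal by
        \<open>t\<close>.\<close>
      have "mono_arr (Pt X ?E) (AMap (pb_functor X p) ?F)"
        using P.mono_from_terminal[OF X.pb_functor_AMap_in[OF ph F]] t unfolding eq by blast
      then have "mono_arr (Pt X ?B) ?F"
        using f p F unfolding reflects_monomorphisms_def by (metis sel(1,2))
      then show ?thesis using X.mono_Pt_iff[OF F] X.terminal_point_iff_mono S unfolding eq by blast
    qed
    then show "reflects_terminal_objects (pb_functor X p)"
      unfolding reflects_terminal_objects_def sel Pt_sel by blast
  qed
  have eb: ?b if e: ?e
    unfolding b_iff
  proof (intro allI impI)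
    fix B A \<alpha> \<beta> assume S: "(A, \<alpha>, \<beta>) \<in> points X B" and tr: "X.trivial_kernel \<alpha>"
    have B: "B \<in> Obj X" using S X.hom_Obj unfolding points_iff by blast
    \<comment> \<open>Along this morphism the pullback functor plays the role of
      \<open>Ker X B\<close>.\<close>
    let ?p = "X.zero z B"
    have p: "?p \<in> hom X z B" using X.zero_in[OF z(4) B] .
    note pD = X.Dom_hom[OF p] and pC = X.Cod_hom[OF p]
    have sel: "Src (pb_functor X ?p) = Pt X B" "Tgt (pb_functor X ?p) = Pt X z"
      "OMap (pb_functor X ?p) = pb_point X ?p"
      by (simp_all add: pb_functor_def pD pC)
    have "reflects_terminal_objects (pb_functor X ?p)" using e X.ArrI[OF p] by blast
    then have "terminal (Pt X B) (A, \<alpha>, \<beta>)"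
      using X.trivial_kernel_imp_terminal_pb[OF p S z(1) tr] S
      unfolding reflects_terminal_objects_def sel Pt_sel by blast
    then show "mono_arr X \<alpha>" using X.terminal_point_iff_mono[OF S] by blast
  qed
  \<comment> \<open>All conditions are tied to (a): directly for (b) and (d), by the cycle a, c, b
    for (c), and by the cycle a, f, e, b for (e) and (f).\<close>
  show ?thesis unfolding Let_def using ab ac cb ad da af fe eb by argo
qed

end
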